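(* Let $G$ be a simply connected $n$-dimensional Lie group endowed with a complete left-invariant affine structure with developing map $D:G\to\mathbb R^n$, $D(1_G)=0$, and let $\Gamma\le G$ be a lattice such that $\rho(\gamma)\in GL(n,\mathbb Z)$ for all $\gamma\in\Gamma$, where $\rho$ is the linear part of the associated affine representation. Let $X=T^*B/\Lambda^*\to B=G/\Gamma$ be the torus bundle induced by the integral affine structure defined by the triple $(G,\Gamma,D)$, and let $\check X=TB/\Lambda\to B$ be its dual torus bundle. Then: 1. The total space $X$ is acted on transitively by the semidirect product $G\ltimes_{\rho^*}(\mathbb R^n)^*$ with stabilizer $\Gamma\ltimes_{\rho^*}(\mathbb Z^n)^*$, where $\rho^*:G\to GL((\mathbb R^n)^* )$ is the dual representation induced by $\rho$. 2. The total space $\check X$ is acted on transitively by the semidirect product $G\ltimes_\rho\mathbb R^n$ with stabilizer $\Gamma\ltimes_\rho\mathbb Z^n$.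
   Context: An affine structure on an $n$-manifold is an atlas whose transition functions are restrictions of affine maps; it is integral if the linear parts of the transition functions lie in $GL(n,\mathbb Z)$, and complete if its developing map from the universal cover to $\mathbb R^n$ is a homeomorphism. A complete left-invariant affine structure on the simply connected group $G$ amounts to a diffeomorphism $D:G\to\mathbb R^n$ such that, for every $g\in G$, $\alpha(g)=D\circ L_g\circ D^{-1}$ is an affine transformation of $\mathbb R^n$ ($L_g$ is left multiplication). This gives $\alpha:G\to\mathrm{Aff}(\mathbb R^n)$, with linear part $\rho:G\to GL(n,\mathbb R)$. A lattice is a discrete cocompact subgroup. $B=G/\Gamma$ denotes the set of right cosets $\Gamma h$, $h\in G$, with projection $\pi:G\to B$. The components $r_1,\dots,r_n$ of $D$ induce local affine coordinates of an integral affine structure on $B$. The fibrewise lattice $\Lambda\subset TB$ is locally generated by $\partial/\partial r_1,\dots,\partial/\partial r_n$, that is, $\Lambda_{\Gamma h}$ is the $\mathbb Z$-span of $d(\pi\circ D^{-1})_{D(h)}e_i$, $i=1,\dots,n$, with $e_i$ the standard basis of $\mathbb R^n$. The fibrewise lattice $\Lambda^*\subset T^*B$ is locally generated by $dr_1,\dots,dr_n$. Both are well defined since $\rho(\Gamma)\subset GL(n,\mathbb Z)$. For a representation $\sigma$ of $G$ on a vector space $V$, $G\ltimes_\sigma V$ is $G\times V$ with product $(g',y')(g,y)=(g'g,\,y'+\sigma(g')y)$. The stabilizer is meant as the isotropy group of the origin of the fibre over the coset $\Gamma\in B$. *)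

theory Defs
  imports "HOL-Analysis.Analysis" "HOL-Algebra.Group_Action"
begin

section \<open>Smooth manifolds\<close>

text \<open>
  \<open>Ck_on k S f\<close>, for open \<open>S\<close>: all iterated directional derivatives of \<open>f\<close> up to order \<open>k\<close>
  exist and are continuous on \<open>S\<close>. All spaces used below are finite-dimensional, where this is
  the usual notion of class \<open>C\<^sup>k\<close>.
\<close>

fun Ck_on :: "nat \<Rightarrow> 'a::real_normed_vector set \<Rightarrow> ('a \<Rightarrow> 'b::real_normed_vector) \<Rightarrow> bool" where
  "Ck_on 0 S f = continuous_on S f"
| "Ck_on (Suc k) S f =
    ((\<forall>x\<in>S. f differentiable (at x)) \<and> (\<forall>v. Ck_on k S (\<lambda>x. frechet_derivative f (at x) v)))"

definition smooth_on :: "'a::real_normed_vector set \<Rightarrow> ('a \<Rightarrow> 'b::real_normed_vector) \<Rightarrow> bool" where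
  "smooth_on S f \<longleftrightarrow> (\<forall>k. Ck_on k S f)"

text \<open>
  A chart is a pair of a domain and a map; the values of the map outside the domain are irrelevant.
  An atlas determines both the underlying set and the topology of its manifold.
\<close>

type_synonym ('a, 'e) chart = "'a set \<times> ('a \<Rightarrow> 'e)"
type_synonym ('a, 'e) atlas = "('a, 'e) chart set"

definition points :: "('a, 'e) atlas \<Rightarrow> 'a set" where
  "points A = \<Union> (fst ` A)"

definition charts_at :: "('a, 'e) atlas \<Rightarrow> 'a \<Rightarrow> ('a, 'e) chart set" where
  "charts_at A p = {c \<in> A. p \<in> fst c}"

definition smooth_atlas :: "('a, 'e::real_normed_vector) atlas \<Rightarrow> bool" where
  "smooth_atlas A \<longleftrightarrow>
    (\<forall>(U, \<phi>)\<in>A. inj_on \<phi> U \<and> open (\<phi> ` U)) \<and>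
    (\<forall>(U, \<phi>)\<in>A. \<forall>(V, \<psi>)\<in>A.
        open (\<phi> ` (U \<inter> V)) \<and> smooth_on (\<phi> ` (U \<inter> V)) (\<psi> \<circ> inv_into U \<phi>))"

text \<open>For a smooth atlas the open sets below do form a topology (lemma \<open>openin_manifold_topology\<close>).\<close>

definition manifold_topology :: "('a, 'e::real_normed_vector) atlas \<Rightarrow> 'a topology" where
  "manifold_topology A =
    topology (\<lambda>W. W \<subseteq> points A \<and> (\<forall>(U, \<phi>)\<in>A. open (\<phi> ` (W \<inter> U))))"

lemma openin_manifold_topology:
  assumes "smooth_atlas A"
  shows "openin (manifold_topology A) W \<longleftrightarrow> W \<subseteq> points A \<and> (\<forall>(U, \<phi>)\<in>A. open (\<phi> ` (W \<inter> U)))"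
proof -
  let ?P = "\<lambda>W. W \<subseteq> points A \<and> (\<forall>(U, \<phi>)\<in>A. open (\<phi> ` (W \<inter> U)))"
  have "?P (S \<inter> T)" if "?P S" "?P T" for S T
  proof -
    have "open (\<phi> ` (S \<inter> T \<inter> U))" if c: "(U, \<phi>) \<in> A" for U \<phi>
    proof -
      have "inj_on \<phi> U"
        using assms c by (auto simp: smooth_atlas_def)
      then have "\<phi> ` (S \<inter> T \<inter> U) = \<phi> ` (S \<inter> U) \<inter> \<phi> ` (T \<inter> U)"
        by (auto simp: inj_on_def)
      then show ?thesis
        using \<open>?P S\<close> \<open>?P T\<close> c by (auto intro!: open_Int)
    qed
    then show ?thesis
      using \<open>?P S\<close> by auto
  qed
  moreover have "?P (\<Union> \<K>)" if "\<forall>K\<in>\<K>. ?P K" for \<K>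
  proof -
    have "open (\<phi> ` (\<Union> \<K> \<inter> U))" if c: "(U, \<phi>) \<in> A" for U \<phi>
    proof -
      have "\<phi> ` (\<Union> \<K> \<inter> U) = (\<Union>K\<in>\<K>. \<phi> ` (K \<inter> U))"
        by auto
      moreover have "open (\<phi> ` (K \<inter> U))" if "K \<in> \<K>" for K
        using \<open>\<forall>K\<in>\<K>. ?P K\<close> that c by fast
      ultimately show ?thesis
        by auto
    qed
    then show ?thesis
      using that by auto
  qed
  ultimately have "istopology ?P"
    unfolding istopology_def by blast
  then show ?thesis
    by (simp add: manifold_topology_def topology_inverse')
qed

definition smooth_manifold :: "'a set \<Rightarrow> ('a, 'e::real_normed_vector) atlas \<Rightarrow> bool" where
  "smooth_manifold M A \<longleftrightarrow>
    smooth_atlas A \<and> points A = M \<and>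
    Hausdorff_space (manifold_topology A) \<and>
    (\<exists>\<B>. countable \<B> \<and> (\<forall>V\<in>\<B>. openin (manifold_topology A) V) \<and>
         (\<forall>U x. openin (manifold_topology A) U \<and> x \<in> U \<longrightarrow> (\<exists>V\<in>\<B>. x \<in> V \<and> V \<subseteq> U)))"

text \<open>The local representative of \<open>f\<close> is taken on a small part \<open>W\<close> of a chart domain, because the
  atlases are not required to be maximal.\<close>

definition smooth_map ::
  "('a, 'e::real_normed_vector) atlas \<Rightarrow> ('b, 'f::real_normed_vector) atlas \<Rightarrow> ('a \<Rightarrow> 'b) \<Rightarrow> bool" where
  "smooth_map A B f \<longleftrightarrow>
    (\<forall>p\<in>points A. \<exists>(U, \<phi>)\<in>A. \<exists>(V, \<psi>)\<in>B. \<exists>W.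
        p \<in> W \<and> W \<subseteq> U \<and> open (\<phi> ` W) \<and> f ` W \<subseteq> V \<and>
        smooth_on (\<phi> ` W) (\<psi> \<circ> f \<circ> inv_into U \<phi>))"

definition vector_space_atlas :: "('e, 'e) atlas" where
  "vector_space_atlas = {(UNIV, id)}"

definition product_atlas :: "('a, 'e) atlas \<Rightarrow> ('b, 'f) atlas \<Rightarrow> ('a \<times> 'b, 'e \<times> 'f) atlas" where
  "product_atlas A B = {(U \<times> V, map_prod \<phi> \<psi>) | U \<phi> V \<psi>. (U, \<phi>) \<in> A \<and> (V, \<psi>) \<in> B}"

text \<open>The structure induced on the image of \<open>q\<close>, for \<open>q\<close> a covering map: charts are
  \<open>\<phi> \<circ> (q|U)\<inverse>\<close> for open parts \<open>U\<close> of chart domains on which \<open>q\<close> is injective.\<close>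

definition quotient_atlas :: "('a, 'e::real_normed_vector) atlas \<Rightarrow> ('a \<Rightarrow> 'b) \<Rightarrow> ('b, 'e) atlas" where
  "quotient_atlas A q =
    {(q ` U, \<phi> \<circ> inv_into U q) | U V \<phi>.
        (V, \<phi>) \<in> A \<and> U \<subseteq> V \<and> open (\<phi> ` U) \<and> inj_on q U}"


section \<open>Tangent and cotangent bundles\<close>

text \<open>
  A tangent vector at \<open>p\<close> is the family \<open>\<xi>\<close> of its coordinate vectors in all charts at \<open>p\<close>,
  related by the derivatives of the transition functions (and zero at all other charts, so that
  vectors are determined by their coordinates). Vector space operations are pointwise.
\<close>

definition tangent_space :: "('a, 'e::real_normed_vector) atlas \<Rightarrow> 'a \<Rightarrow> (('a, 'e) chart \<Rightarrow> 'e) set" where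
  "tangent_space A p =
    {\<xi>. (\<forall>c. c \<notin> charts_at A p \<longrightarrow> \<xi> c = 0) \<and>
        (\<forall>(U, \<phi>)\<in>charts_at A p. \<forall>(V, \<psi>)\<in>charts_at A p.
            \<xi> (V, \<psi>) = frechet_derivative (\<psi> \<circ> inv_into U \<phi>) (at (\<phi> p)) (\<xi> (U, \<phi>)))}"

definition tangent_bundle ::
  "('a, 'e::real_normed_vector) atlas \<Rightarrow> ('a \<times> (('a, 'e) chart \<Rightarrow> 'e)) set" where
  "tangent_bundle A = (SIGMA p : points A. tangent_space A p)"

definition tangent_atlas ::
  "('a, 'e::real_normed_vector) atlas \<Rightarrow> ('a \<times> (('a, 'e) chart \<Rightarrow> 'e), 'e \<times> 'e) atlas" where
  "tangent_atlas A =
    {((SIGMA p : U. tangent_space A p), (\<lambda>(p, \<xi>). (\<phi> p, \<xi> (U, \<phi>)))) | U \<phi>. (U, \<phi>) \<in> A}"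

text \<open>\<open>differential A f x v\<close> is the tangent vector \<open>df\<^sub>x(v)\<close> at \<open>f x\<close>, for a map \<open>f\<close> from
  (an open subset of) the vector space \<open>'d\<close> to the manifold with atlas \<open>A\<close>.\<close>

definition differential ::
  "('a, 'e::real_normed_vector) atlas \<Rightarrow> ('d::real_normed_vector \<Rightarrow> 'a) \<Rightarrow> 'd \<Rightarrow> 'd
    \<Rightarrow> ('a, 'e) chart \<Rightarrow> 'e" where
  "differential A f x v =
    (\<lambda>c. if c \<in> charts_at A (f x) then frechet_derivative (snd c \<circ> f) (at x) v else 0)"

text \<open>Covectors are linear functionals on the tangent space, extended by zero.\<close>

definition cotangent_space ::
  "('a, 'e::real_normed_vector) atlas \<Rightarrow> 'a \<Rightarrow> ((('a, 'e) chart \<Rightarrow> 'e) \<Rightarrow> real) set" where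
  "cotangent_space A p =
    {\<omega>. (\<forall>\<xi>. \<xi> \<notin> tangent_space A p \<longrightarrow> \<omega> \<xi> = 0) \<and>
        (\<forall>\<xi>\<in>tangent_space A p. \<forall>\<eta>\<in>tangent_space A p. \<omega> (\<lambda>c. \<xi> c + \<eta> c) = \<omega> \<xi> + \<omega> \<eta>) \<and>
        (\<forall>a. \<forall>\<xi>\<in>tangent_space A p. \<omega> (\<lambda>c. a *\<^sub>R \<xi> c) = a * \<omega> \<xi>)}"

definition cotangent_bundle ::
  "('a, 'e::real_normed_vector) atlas \<Rightarrow> ('a \<times> ((('a, 'e) chart \<Rightarrow> 'e) \<Rightarrow> real)) set" where
  "cotangent_bundle A = (SIGMA p : points A. cotangent_space A p)"

text \<open>Here \<open>differential A (inv_into U \<phi>) (\<phi> p) v\<close> is the tangent vector at \<open>p\<close> whose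
  coordinate vector in the chart \<open>(U, \<phi>)\<close> is \<open>v\<close>.\<close>

definition cotangent_atlas ::
  "('a, 'e::real_normed_vector) atlas
    \<Rightarrow> ('a \<times> ((('a, 'e) chart \<Rightarrow> 'e) \<Rightarrow> real), 'e \<times> ('e \<Rightarrow>\<^sub>L real)) atlas" where
  "cotangent_atlas A =
    {((SIGMA p : U. cotangent_space A p),
      (\<lambda>(p, \<omega>). (\<phi> p, Blinfun (\<lambda>v. \<omega> (differential A (inv_into U \<phi>) (\<phi> p) v))))) | U \<phi>.
        (U, \<phi>) \<in> A}"

text \<open>The covector \<open>df\<^sub>p\<close> of a real function \<open>f\<close> defined near \<open>p\<close>; it does not depend on the
  chart chosen.\<close>

definition function_differential ::
  "('a, 'e::real_normed_vector) atlas \<Rightarrow> ('a \<Rightarrow> real) \<Rightarrow> 'a \<Rightarrow> (('a, 'e) chart \<Rightarrow> 'e) \<Rightarrow> real" where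
  "function_differential A f p \<xi> =
    (if \<xi> \<in> tangent_space A p then
       (let (U, \<phi>) = (SOME c. c \<in> charts_at A p)
        in frechet_derivative (f \<circ> inv_into U \<phi>) (at (\<phi> p)) (\<xi> (U, \<phi>)))
     else 0)"

text \<open>The fibrewise quotient of a bundle \<open>E\<close> (with fibres of functions, added pointwise) by
  subgroups \<open>L p\<close> of its fibres.\<close>

definition fibre_rel ::
  "('a \<times> ('x \<Rightarrow> 'v::ab_group_add)) set \<Rightarrow> ('a \<Rightarrow> ('x \<Rightarrow> 'v) set)
    \<Rightarrow> (('a \<times> ('x \<Rightarrow> 'v)) \<times> ('a \<times> ('x \<Rightarrow> 'v))) set" where
  "fibre_rel E L =
    {((p, \<xi>), (p', \<xi>')). (p, \<xi>) \<in> E \<and> (p', \<xi>') \<in> E \<and> p = p' \<and> (\<lambda>c. \<xi>' c - \<xi> c) \<in> L p}"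

definition fibre_proj ::
  "('a \<times> ('x \<Rightarrow> 'v::ab_group_add)) set \<Rightarrow> ('a \<Rightarrow> ('x \<Rightarrow> 'v) set)
    \<Rightarrow> 'a \<times> ('x \<Rightarrow> 'v) \<Rightarrow> ('a \<times> ('x \<Rightarrow> 'v)) set" where
  "fibre_proj E L x = fibre_rel E L `` {x}"


section \<open>Lie groups, lattices and affine structures\<close>

definition lie_group :: "('g, 'm) monoid_scheme \<Rightarrow> ('g, 'e::real_normed_vector) atlas \<Rightarrow> bool" where
  "lie_group G A \<longleftrightarrow>
    group G \<and> smooth_manifold (carrier G) A \<and>
    smooth_map (product_atlas A A) A (\<lambda>(g, h). g \<otimes>\<^bsub>G\<^esub> h) \<and>
    smooth_map A A (\<lambda>g. inv\<^bsub>G\<^esub> g)"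

text \<open>The definition of \<^const>\<open>simply_connected\<close>, for abstract topologies.\<close>

definition simply_connected_space :: "'a topology \<Rightarrow> bool" where
  "simply_connected_space T \<longleftrightarrow>
    (\<forall>p q. pathin T p \<and> p 1 = p 0 \<and> pathin T q \<and> q 1 = q 0 \<longrightarrow>
        homotopic_with (\<lambda>r. r 1 = r 0) (top_of_set {0..1}) T p q)"

definition quotient_topology :: "'a topology \<Rightarrow> ('a \<Rightarrow> 'b) \<Rightarrow> 'b topology" where
  "quotient_topology T q =
    topology (\<lambda>W. W \<subseteq> q ` topspace T \<and> openin T {x \<in> topspace T. q x \<in> W})"

definition lattice_in ::
  "'g set \<Rightarrow> ('g, 'm) monoid_scheme \<Rightarrow> ('g, 'e::real_normed_vector) atlas \<Rightarrow> bool" where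
  "lattice_in \<Gamma> G A \<longleftrightarrow>
    subgroup \<Gamma> G \<and>
    subtopology (manifold_topology A) \<Gamma> = discrete_topology \<Gamma> \<and>
    compact_space (quotient_topology (manifold_topology A) (\<lambda>h. \<Gamma> #>\<^bsub>G\<^esub> h))"

definition affine_rep ::
  "('g, 'm) monoid_scheme \<Rightarrow> ('g \<Rightarrow> real ^ 'n) \<Rightarrow> 'g \<Rightarrow> real ^ 'n \<Rightarrow> real ^ 'n" where
  "affine_rep G D g = D \<circ> (\<lambda>h. g \<otimes>\<^bsub>G\<^esub> h) \<circ> inv_into (carrier G) D"

definition affine_transformation :: "(real ^ 'n \<Rightarrow> real ^ 'n) \<Rightarrow> bool" where
  "affine_transformation f \<longleftrightarrow> bij f \<and> (\<exists>T b. linear T \<and> (\<forall>x. f x = T x + b))"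

definition complete_left_invariant_affine_structure ::
  "('g, 'm) monoid_scheme \<Rightarrow> ('g, real ^ 'n) atlas \<Rightarrow> ('g \<Rightarrow> real ^ 'n) \<Rightarrow> bool" where
  "complete_left_invariant_affine_structure G A D \<longleftrightarrow>
    bij_betw D (carrier G) UNIV \<and>
    smooth_map A vector_space_atlas D \<and>
    smooth_map vector_space_atlas A (inv_into (carrier G) D) \<and>
    (\<forall>g\<in>carrier G. affine_transformation (affine_rep G D g))"

definition linear_rep ::
  "('g, 'm) monoid_scheme \<Rightarrow> ('g \<Rightarrow> real ^ 'n) \<Rightarrow> 'g \<Rightarrow> real ^ 'n ^ 'n" where
  "linear_rep G D g = matrix (\<lambda>x. affine_rep G D g x - affine_rep G D g 0)"

definition GL_int :: "(real ^ 'n ^ 'n) set" where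
  "GL_int = {M. (\<forall>i j. M $ i $ j \<in> \<int>) \<and>
     (\<exists>N. (\<forall>i j. N $ i $ j \<in> \<int>) \<and> M ** N = mat 1 \<and> N ** M = mat 1)}"

definition rep_action ::
  "('g, 'm) monoid_scheme \<Rightarrow> ('g \<Rightarrow> real ^ 'n) \<Rightarrow> 'g \<Rightarrow> real ^ 'n \<Rightarrow> real ^ 'n" where
  "rep_action G D g y = linear_rep G D g *v y"

definition dual_rep_action ::
  "('g, 'm) monoid_scheme \<Rightarrow> ('g \<Rightarrow> real ^ 'n) \<Rightarrow> 'g
    \<Rightarrow> ((real ^ 'n) \<Rightarrow>\<^sub>L real) \<Rightarrow> ((real ^ 'n) \<Rightarrow>\<^sub>L real)" where
  "dual_rep_action G D g l = l o\<^sub>L Blinfun (rep_action G D (inv\<^bsub>G\<^esub> g))"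

definition int_vectors :: "(real ^ 'n) set" where
  "int_vectors = {v. \<forall>i. v $ i \<in> \<int>}"

definition int_covectors :: "((real ^ 'n) \<Rightarrow>\<^sub>L real) set" where
  "int_covectors = {l. \<forall>v\<in>int_vectors. blinfun_apply l v \<in> \<int>}"

definition semidirect ::
  "('g, 'm) monoid_scheme \<Rightarrow> ('g \<Rightarrow> 'v::ab_group_add \<Rightarrow> 'v) \<Rightarrow> 'v set \<Rightarrow> ('g \<times> 'v) monoid" where
  "semidirect G \<sigma> V =
    \<lparr>carrier = carrier G \<times> V,
     mult = (\<lambda>(g', y') (g, y). (g' \<otimes>\<^bsub>G\<^esub> g, y' + \<sigma> g' y)),
     one = (\<one>\<^bsub>G\<^esub>, 0)\<rparr>"


section \<open>The base and the two torus bundles\<close>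

text \<open>The integral affine atlas of \<open>B = rcosets\<^bsub>G\<^esub> \<Gamma>\<close>: its charts are the systems of local affine
  coordinates \<open>(r\<^sub>1, \<dots>, r\<^sub>n)\<close> induced by \<open>D\<close>.\<close>

definition base_atlas ::
  "('g, 'm) monoid_scheme \<Rightarrow> 'g set \<Rightarrow> ('g \<Rightarrow> real ^ 'n) \<Rightarrow> ('g set, real ^ 'n) atlas" where
  "base_atlas G \<Gamma> D = quotient_atlas {(carrier G, D)} (\<lambda>h. \<Gamma> #>\<^bsub>G\<^esub> h)"

text \<open>The integer span of \<open>d(\<pi> \<circ> D\<inverse>)\<^bsub>D(h)\<^esub> e\<^sub>i\<close> at \<open>p = \<Gamma>h\<close>.\<close>

definition Lam ::
  "('g, 'm) monoid_scheme \<Rightarrow> 'g set \<Rightarrow> ('g \<Rightarrow> real ^ 'n) \<Rightarrow> 'g set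
    \<Rightarrow> (('g set, real ^ 'n) chart \<Rightarrow> real ^ 'n) set" where
  "Lam G \<Gamma> D p =
    {(\<lambda>c. \<Sum>i\<in>UNIV. of_int (z i) *\<^sub>R
        differential (base_atlas G \<Gamma> D) (\<lambda>x. \<Gamma> #>\<^bsub>G\<^esub> inv_into (carrier G) D x) (D h) (axis i 1) c)
      | h z. h \<in> carrier G \<and> p = \<Gamma> #>\<^bsub>G\<^esub> h \<and> (z :: 'n \<Rightarrow> int) \<in> UNIV}"

text \<open>The integer span of \<open>dr\<^sub>i\<close> at \<open>p\<close>, with \<open>r\<close> a system of local affine coordinates at \<open>p\<close>.\<close>

definition Lam_dual ::
  "('g, 'm) monoid_scheme \<Rightarrow> 'g set \<Rightarrow> ('g \<Rightarrow> real ^ 'n) \<Rightarrow> 'g set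
    \<Rightarrow> ((('g set, real ^ 'n) chart \<Rightarrow> real ^ 'n) \<Rightarrow> real) set" where
  "Lam_dual G \<Gamma> D p =
    {(\<lambda>\<xi>. \<Sum>i\<in>UNIV. of_int (z i) * function_differential (base_atlas G \<Gamma> D) (\<lambda>b. r b $ i) p \<xi>)
      | U r z. (U, r) \<in> charts_at (base_atlas G \<Gamma> D) p \<and> (z :: 'n \<Rightarrow> int) \<in> UNIV}"

definition X_proj where
  "X_proj G \<Gamma> D = fibre_proj (cotangent_bundle (base_atlas G \<Gamma> D)) (Lam_dual G \<Gamma> D)"

definition X_total where
  "X_total G \<Gamma> D =
    cotangent_bundle (base_atlas G \<Gamma> D)
      // fibre_rel (cotangent_bundle (base_atlas G \<Gamma> D)) (Lam_dual G \<Gamma> D)"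

definition X_atlas where
  "X_atlas G \<Gamma> D = quotient_atlas (cotangent_atlas (base_atlas G \<Gamma> D)) (X_proj G \<Gamma> D)"

definition X_origin where
  "X_origin G \<Gamma> D = X_proj G \<Gamma> D (\<Gamma>, \<lambda>_. 0)"

definition Xdual_proj where
  "Xdual_proj G \<Gamma> D = fibre_proj (tangent_bundle (base_atlas G \<Gamma> D)) (Lam G \<Gamma> D)"

definition Xdual_total where
  "Xdual_total G \<Gamma> D =
    tangent_bundle (base_atlas G \<Gamma> D)
      // fibre_rel (tangent_bundle (base_atlas G \<Gamma> D)) (Lam G \<Gamma> D)"

definition Xdual_atlas where
  "Xdual_atlas G \<Gamma> D = quotient_atlas (tangent_atlas (base_atlas G \<Gamma> D)) (Xdual_proj G \<Gamma> D)"

definition Xdual_origin where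
  "Xdual_origin G \<Gamma> D = Xdual_proj G \<Gamma> D (\<Gamma>, \<lambda>_. 0)"

text \<open>A smooth transitive left action \<open>\<Phi>\<close> of a group \<open>H\<close> (with atlas \<open>AH\<close>) on \<open>X\<close> (with atlas \<open>AX\<close>).\<close>

definition smooth_transitive_action ::
  "('h, 'm) monoid_scheme \<Rightarrow> ('h, 'e::real_normed_vector) atlas \<Rightarrow> 'x set
    \<Rightarrow> ('x, 'f::real_normed_vector) atlas \<Rightarrow> ('h \<Rightarrow> 'x \<Rightarrow> 'x) \<Rightarrow> bool" where
  "smooth_transitive_action H AH X AX \<Phi> \<longleftrightarrow>
    transitive_action H X \<Phi> \<and>
    smooth_map (product_atlas AH AX) AX (\<lambda>(h, x). \<Phi> h x)"

end

theory Submission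
  imports Defs
begin

text \<open>
  Set \<open>H = G \<ltimes> V\<close>, where \<open>V\<close> is \<open>\<real>\<^sup>n\<close> or its dual. Since \<open>D (\<gamma> h) = D \<gamma> + \<rho>(\<gamma>) (D h)\<close>, the change of
  the local affine coordinates of \<open>B\<close> under \<open>\<gamma> \<in> \<Gamma>\<close> has the constant derivative \<open>\<rho>(\<gamma>)\<close>. Pulled back
  to \<open>G\<close>, the (co)tangent bundle of \<open>B\<close> is therefore \<open>G \<times> V\<close> with \<open>(h, v)\<close> and \<open>(\<gamma>h, \<rho>(\<gamma>)v)\<close>
  identified, and integrality of \<open>\<rho>(\<gamma>)\<close> makes the fibrewise lattice the constant one \<open>M\<close>
  (\<open>\<int>\<^sup>n\<close> or its dual). So the torus bundle is the set of cosets \<open>(\<Gamma> \<ltimes> M) a\<close>, \<open>a \<in> H\<close>, on which \<open>H\<close> acts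
  by right multiplication with the inverse; the coset of \<open>1\<close> has stabilizer \<open>\<Gamma> \<ltimes> M\<close>. In the coordinates
  given by \<open>D\<close> the action is
  \<open>(h, v) \<mapsto> (h g\<inverse>, v - \<rho>(h g\<inverse>) y)\<close>, which is smooth because \<open>\<rho>(g) y = D (g (D\<inverse> y)) - D g\<close>.
\<close>

section \<open>Calculus of smooth functions\<close>

text \<open>Points of \<open>B\<close> are cosets \<Gamma>h, so right translations of
  \<open>G\<close> descend to \<open>B\<close> while left ones in general do not; taking inverses
  makes the descended action a left one. The work lies in smoothness. Atlases need not be maximal,
  and charts of a torus bundle exist only where the fibrewise quotient map is injective.
  Discreteness of \<Gamma> gives small open sets of \<open>G\<close> that meet every coset at most
  once, discreteness of \<open>M\<close> gives balls of radius \<open>\<epsilon> / 2\<close> that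
  meet every class modulo \<open>M\<close> at most once, and their products carry the charts. The
  atlas of \<open>G\<close> is tied to \<open>D\<close> only by smoothness of \<open>D\<close> and
  of its inverse; this turns the group operations into smooth maps of vector spaces. In the action
  formula a term \<sigma>(g) y occurs in which both \<open>g\<close> and \<open>y\<close> vary. It
  is read as the bilinear application of a smooth operator-valued map \<open>R\<close>, so that one
  argument serves vectors and covectors alike.\<close>

lemma frechet_derivative_eq:
  assumes "(f has_derivative f') (at x)"
  shows "frechet_derivative f (at x) = f'"
  using assms frechet_derivative_at by metis

lemma frechet_derivative_cong_open:
  assumes "open S" "x \<in> S" "\<And>y. y \<in> S \<Longrightarrow> f y = g y" "f differentiable (at x)"
  shows "frechet_derivative f (at x) = frechet_derivative g (at x)" "g differentiable (at x)"
proof -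
  obtain f' where f': "(f has_derivative f') (at x)"
    using assms(4) by (auto simp: differentiable_def)
  then have g': "(g has_derivative f') (at x)"
    using has_derivative_transform_within_open assms(1-3) by blast
  then show "g differentiable (at x)"
    by (auto simp: differentiable_def)
  show "frechet_derivative f (at x) = frechet_derivative g (at x)"
    using f' g' by (simp add: frechet_derivative_eq)
qed

lemma Ck_on_cong:
  assumes "Ck_on k S f" "open S" "\<And>x. x \<in> S \<Longrightarrow> f x = g x"
  shows "Ck_on k S g"
  using assms(1,3)
proof (induction k arbitrary: f g)
  case 0
  then show ?case by (auto cong: continuous_on_cong)
next
  case (Suc k)
  show ?case
    unfolding Ck_on.simps
  proof (intro conjI ballI allI)
    fix x assume "x \<in> S"
    then show "g differentiable (at x)"
      using frechet_derivative_cong_open(2)[OF assms(2), of x f g] Suc.prems by auto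
  next
    fix v
    show "Ck_on k S (\<lambda>x. frechet_derivative g (at x) v)"
    proof (rule Suc.IH)
      show "Ck_on k S (\<lambda>x. frechet_derivative f (at x) v)"
        using Suc.prems by auto
      show "frechet_derivative f (at x) v = frechet_derivative g (at x) v" if "x \<in> S" for x
        using frechet_derivative_cong_open(1)[OF assms(2) that, of f g] Suc.prems that by auto
    qed
  qed
qed

text \<open>Together with \<open>Ck_on_Suc_E\<close> this trades the selected
  \<open>frechet_derivative\<close> for any explicit derivative \<open>f'\<close>, so the inductions
  below can use the usual differentiation rules. Openness of \<open>S\<close> lets the two
  derivatives replace each other at all higher orders.\<close>

lemma Ck_on_Suc_I:
  assumes "open S" "\<And>x. x \<in> S \<Longrightarrow> (f has_derivative f' x) (at x)"
    and "\<And>v. Ck_on k S (\<lambda>x. f' x v)"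
  shows "Ck_on (Suc k) S f"
  unfolding Ck_on.simps
proof (intro conjI ballI allI)
  show "f differentiable (at x)" if "x \<in> S" for x
    using assms(2)[OF that] by (auto simp: differentiable_def)
  show "Ck_on k S (\<lambda>x. frechet_derivative f (at x) v)" for v
    by (rule Ck_on_cong[OF assms(3) assms(1)]) (simp add: frechet_derivative_eq[OF assms(2)])
qed

lemma Ck_on_Suc_E:
  assumes "Ck_on (Suc k) S f"
  obtains f' where "\<And>x. x \<in> S \<Longrightarrow> (f has_derivative f' x) (at x)" "\<And>v. Ck_on k S (\<lambda>x. f' x v)"
  using that[of "\<lambda>x. frechet_derivative f (at x)"] assms by (auto simp: frechet_derivative_works)

lemma Ck_on_subset: "Ck_on k S f \<Longrightarrow> T \<subseteq> S \<Longrightarrow> Ck_on k T f"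
  by (induction k arbitrary: f) (auto intro: continuous_on_subset)

lemma Ck_on_Suc_imp: "Ck_on (Suc k) S f \<Longrightarrow> Ck_on k S f"
proof (induction k arbitrary: f)
  case 0
  then show ?case
    by (auto intro!: continuous_at_imp_continuous_on differentiable_imp_continuous_within)
qed auto

text \<open>Derivatives are taken in the whole space, so open neighbourhoods \<open>T\<close>
  suffice even where they leave \<open>S\<close>.\<close>

lemma Ck_on_local:
  assumes "\<And>x. x \<in> S \<Longrightarrow> \<exists>T. open T \<and> x \<in> T \<and> Ck_on k T f"
  shows "Ck_on k S f"
  using assms
proof (induction k arbitrary: f)
  case 0
  then have "isCont f x" if "x \<in> S" for x
    using that by (metis Ck_on.simps(1) continuous_on_eq_continuous_at)
  then show ?case
    by (auto intro!: continuous_at_imp_continuous_on)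
next
  case (Suc k)
  have "Ck_on k S (\<lambda>x. frechet_derivative f (at x) v)" for v
    by (rule Suc.IH) (use Suc.prems in fastforce)
  moreover have "f differentiable (at x)" if "x \<in> S" for x
    using Suc.prems[OF that] by auto
  ultimately show ?case
    by simp
qed

lemma Ck_on_const: "Ck_on k S (\<lambda>x. c)"
  by (induction k arbitrary: c) auto

text \<open>One differentiation is enough: the derivative is \<open>f\<close> at every point, so
  each directional derivative is constant in the base point.\<close>

lemma Ck_on_bounded_linear:
  assumes "bounded_linear f"
  shows "Ck_on k S f"
proof (cases k)
  case 0
  then show ?thesis
    using assms by (simp add: linear_continuous_on)
next
  case (Suc j)
  have f': "(f has_derivative f) (at x)" for x
    by (rule bounded_linear_imp_has_derivative[OF assms])
  then show ?thesis
    unfolding Suc Ck_on.simps frechet_derivative_eq[OF f'] by (auto simp: Ck_on_const differentiable_def)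
qed

lemma Ck_on_linear_comp:
  assumes "bounded_linear L" "open S" "Ck_on k S f"
  shows "Ck_on k S (\<lambda>x. L (f x))"
  using assms(3)
proof (induction k arbitrary: f)
  case 0
  then show ?case
    using assms(1) by (simp add: bounded_linear.continuous_on)
next
  case (Suc k)
  obtain f' where f': "\<And>x. x \<in> S \<Longrightarrow> (f has_derivative f' x) (at x)"
      "\<And>v. Ck_on k S (\<lambda>x. f' x v)"
    using Suc.prems by (rule Ck_on_Suc_E) blast
  show ?case
    by (rule Ck_on_Suc_I[OF assms(2) bounded_linear.has_derivative[OF assms(1) f'(1)] Suc.IH])
      (use f' in auto)
qed

text \<open>Differentiating along \<open>v\<close> gives a derivative of \<open>f\<close> along the
  fixed direction \<open>L v\<close>, so the induction closes without a basis of the intermediate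
  space. This covers projections from products of arbitrary normed spaces.\<close>

lemma Ck_on_comp_linear:
  assumes "bounded_linear L" "open S" "Ck_on k T f" "L ` S \<subseteq> T"
  shows "Ck_on k S (\<lambda>x. f (L x))"
  using assms(3)
proof (induction k arbitrary: f)
  case 0
  then have "continuous_on S (f \<circ> L)"
    by (intro continuous_on_compose linear_continuous_on[OF assms(1)])
      (use 0 assms(4) in \<open>auto intro: continuous_on_subset\<close>)
  then show ?case
    by (simp add: o_def)
next
  case (Suc k)
  obtain f' where f': "\<And>x. x \<in> T \<Longrightarrow> (f has_derivative f' x) (at x)"
      "\<And>v. Ck_on k T (\<lambda>x. f' x v)"
    using Suc.prems by (rule Ck_on_Suc_E) blast
  show ?case
  proof (rule Ck_on_Suc_I[OF assms(2)])
    show "((\<lambda>x. f (L x)) has_derivative (\<lambda>v. f' (L x) (L v))) (at x)" if "x \<in> S" for x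
      using diff_chain_at[OF bounded_linear_imp_has_derivative[OF assms(1)] f'(1)] assms(4) that
      by (auto simp: o_def)
  qed (rule Suc.IH, rule f')
qed

lemma Ck_on_add:
  assumes "open S" "Ck_on k S f" "Ck_on k S g"
  shows "Ck_on k S (\<lambda>x. f x + g x)"
  using assms(2,3)
proof (induction k arbitrary: f g)
  case 0
  then show ?case by (simp add: continuous_on_add)
next
  case (Suc k)
  obtain f' where f': "\<And>x. x \<in> S \<Longrightarrow> (f has_derivative f' x) (at x)"
      "\<And>v. Ck_on k S (\<lambda>x. f' x v)"
    using Suc.prems(1) by (rule Ck_on_Suc_E) blast
  obtain g' where g': "\<And>x. x \<in> S \<Longrightarrow> (g has_derivative g' x) (at x)"
      "\<And>v. Ck_on k S (\<lambda>x. g' x v)"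
    using Suc.prems(2) by (rule Ck_on_Suc_E) blast
  show ?case
    by (rule Ck_on_Suc_I[OF assms(1) has_derivative_add[OF f'(1) g'(1)] Suc.IH]) (use f' g' in auto)
qed

lemma Ck_on_sum:
  assumes "open S" "\<And>i. i \<in> I \<Longrightarrow> Ck_on k S (f i)"
  shows "Ck_on k S (\<lambda>x. \<Sum>i\<in>I. f i x)"
  using assms(2)
proof (induction I rule: infinite_finite_induct)
  case (insert i I)
  then show ?case
    using Ck_on_add[OF assms(1), of k "f i" "\<lambda>x. \<Sum>i\<in>I. f i x"] by auto
qed (auto simp: Ck_on_const)

text \<open>The product rule pairs each function with a derivative of the other, so the induction
  also needs \<open>f\<close> and \<open>g\<close> themselves at the lower order;
  \<open>Ck_on_Suc_imp\<close> provides this.\<close>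

lemma Ck_on_bilinear:
  assumes "bounded_bilinear B" "open S" "Ck_on k S f" "Ck_on k S g"
  shows "Ck_on k S (\<lambda>x. B (f x) (g x))"
  using assms(3,4)
proof (induction k arbitrary: f g)
  case 0
  then show ?case
    using assms(1) by (simp add: bounded_bilinear.continuous_on)
next
  case (Suc k)
  obtain f' where f': "\<And>x. x \<in> S \<Longrightarrow> (f has_derivative f' x) (at x)"
      "\<And>v. Ck_on k S (\<lambda>x. f' x v)"
    using Suc.prems(1) by (rule Ck_on_Suc_E) blast
  obtain g' where g': "\<And>x. x \<in> S \<Longrightarrow> (g has_derivative g' x) (at x)"
      "\<And>v. Ck_on k S (\<lambda>x. g' x v)"
    using Suc.prems(2) by (rule Ck_on_Suc_E) blast
  show ?case
    by (rule Ck_on_Suc_I[OF assms(2) bounded_bilinear.FDERIV[OF assms(1) f'(1) g'(1)]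
          Ck_on_add[OF assms(2) Suc.IH Suc.IH]])
      (use f' g' Suc.prems[THEN Ck_on_Suc_imp] in auto)
qed

lemma Ck_on_Pair:
  assumes "open S" "Ck_on k S f" "Ck_on k S g"
  shows "Ck_on k S (\<lambda>x. (f x, g x))"
proof -
  have "Ck_on k S (\<lambda>x. (f x, 0) + (0, g x))"
    by (intro Ck_on_add assms Ck_on_linear_comp[of "\<lambda>x. (x, 0)"] Ck_on_linear_comp[of "\<lambda>x. (0, x)"]
        bounded_linear_Pair bounded_linear_ident bounded_linear_zero)
  then show ?thesis
    by simp
qed

text \<open>The intermediate space is Euclidean so that the derivative of \<open>g\<close> in the varying
  direction \<open>f' x v\<close> expands into derivatives along fixed directions.\<close>

lemma Ck_on_compose:
  fixes f :: "'a::real_normed_vector \<Rightarrow> 'b::euclidean_space" and g :: "'b \<Rightarrow> 'c::real_normed_vector"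
  assumes "open S" "Ck_on k S f" "Ck_on k T g" "f ` S \<subseteq> T"
  shows "Ck_on k S (\<lambda>x. g (f x))"
  using assms(2,3)
proof (induction k arbitrary: g)
  case 0
  then have "continuous_on S (g \<circ> f)"
    by (intro continuous_on_compose) (use 0 assms(4) in \<open>auto intro: continuous_on_subset\<close>)
  then show ?case
    by (simp add: o_def)
next
  case (Suc k)
  obtain f' where f': "\<And>x. x \<in> S \<Longrightarrow> (f has_derivative f' x) (at x)"
      "\<And>v. Ck_on k S (\<lambda>x. f' x v)"
    using Suc.prems(1) by (rule Ck_on_Suc_E) blast
  obtain g' where g': "\<And>x. x \<in> T \<Longrightarrow> (g has_derivative g' x) (at x)"
      "\<And>v. Ck_on k T (\<lambda>x. g' x v)"
    using Suc.prems(2) by (rule Ck_on_Suc_E) blast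
  show ?case
  proof (rule Ck_on_Suc_I[OF assms(1)])
    show "((\<lambda>x. g (f x)) has_derivative (\<lambda>v. \<Sum>b\<in>Basis. (f' x v \<bullet> b) *\<^sub>R g' (f x) b)) (at x)"
      if "x \<in> S" for x
    proof -
      have fx: "f x \<in> T"
        using that assms(4) by auto
      have lin: "linear (g' (f x))"
        by (rule has_derivative_linear[OF g'(1)[OF fx]])
      have "g' (f x) (\<Sum>b\<in>Basis. (w \<bullet> b) *\<^sub>R b) = (\<Sum>b\<in>Basis. (w \<bullet> b) *\<^sub>R g' (f x) b)" for w
        by (simp add: linear_sum[OF lin] linear_scale[OF lin])
      then have "(\<Sum>b\<in>Basis. (w \<bullet> b) *\<^sub>R g' (f x) b) = g' (f x) w" for w
        unfolding euclidean_representation by (rule sym)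
      then have "(\<lambda>v. \<Sum>b\<in>Basis. (f' x v \<bullet> b) *\<^sub>R g' (f x) b) = g' (f x) \<circ> f' x"
        by (simp only: o_def)
      then show ?thesis
        using diff_chain_at[OF f'(1)[OF that] g'(1)[OF fx]] by (simp add: o_def)
    qed
    show "Ck_on k S (\<lambda>x. \<Sum>b\<in>Basis. (f' x v \<bullet> b) *\<^sub>R g' (f x) b)" for v
      by (intro Ck_on_sum assms Ck_on_bilinear[OF bounded_bilinear_scaleR] Suc.IH g'
          Ck_on_linear_comp[OF bounded_linear_inner_left] f' Ck_on_Suc_imp[OF Suc.prems(1)])
  qed
qed

lemma smooth_on_cong:
  "smooth_on S f \<Longrightarrow> open S \<Longrightarrow> (\<And>x. x \<in> S \<Longrightarrow> f x = g x) \<Longrightarrow> smooth_on S g"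
  unfolding smooth_on_def using Ck_on_cong by blast

lemma smooth_on_subset: "smooth_on S f \<Longrightarrow> T \<subseteq> S \<Longrightarrow> smooth_on T f"
  unfolding smooth_on_def using Ck_on_subset by blast

lemma smooth_on_local:
  "(\<And>x. x \<in> S \<Longrightarrow> \<exists>T. open T \<and> x \<in> T \<and> smooth_on T f) \<Longrightarrow> smooth_on S f"
  unfolding smooth_on_def by (meson Ck_on_local)

lemma smooth_on_imp_continuous_on: "smooth_on S f \<Longrightarrow> continuous_on S f"
  unfolding smooth_on_def using Ck_on.simps(1) by blast

lemma smooth_on_const: "smooth_on S (\<lambda>x. c)"
  unfolding smooth_on_def by (simp add: Ck_on_const)

lemma smooth_on_linear_comp:
  "bounded_linear L \<Longrightarrow> open S \<Longrightarrow> smooth_on S f \<Longrightarrow> smooth_on S (\<lambda>x. L (f x))"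
  unfolding smooth_on_def by (simp add: Ck_on_linear_comp)

lemma smooth_on_bounded_linear: "bounded_linear L \<Longrightarrow> smooth_on S L"
  unfolding smooth_on_def by (simp add: Ck_on_bounded_linear)

lemma smooth_on_comp_linear:
  "bounded_linear L \<Longrightarrow> open S \<Longrightarrow> smooth_on T f \<Longrightarrow> L ` S \<subseteq> T \<Longrightarrow> smooth_on S (\<lambda>x. f (L x))"
  unfolding smooth_on_def using Ck_on_comp_linear by blast

lemma smooth_on_add:
  "open S \<Longrightarrow> smooth_on S f \<Longrightarrow> smooth_on S g \<Longrightarrow> smooth_on S (\<lambda>x. f x + g x)"
  unfolding smooth_on_def by (simp add: Ck_on_add)

lemma smooth_on_diff:
  assumes "open S" "smooth_on S f" "smooth_on S g"
  shows "smooth_on S (\<lambda>x. f x - g x)"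
  using smooth_on_add[OF assms(1,2) smooth_on_linear_comp[OF bounded_linear_minus[OF bounded_linear_ident] assms(1,3)]]
  by simp

lemma smooth_on_sum:
  "open S \<Longrightarrow> (\<And>i. i \<in> I \<Longrightarrow> smooth_on S (f i)) \<Longrightarrow> smooth_on S (\<lambda>x. \<Sum>i\<in>I. f i x)"
  unfolding smooth_on_def by (simp add: Ck_on_sum)

lemma smooth_on_bilinear:
  "bounded_bilinear B \<Longrightarrow> open S \<Longrightarrow> smooth_on S f \<Longrightarrow> smooth_on S g
    \<Longrightarrow> smooth_on S (\<lambda>x. B (f x) (g x))"
  unfolding smooth_on_def by (simp add: Ck_on_bilinear)

lemma smooth_on_Pair:
  "open S \<Longrightarrow> smooth_on S f \<Longrightarrow> smooth_on S g \<Longrightarrow> smooth_on S (\<lambda>x. (f x, g x))"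
  unfolding smooth_on_def by (simp add: Ck_on_Pair)

lemma smooth_on_compose:
  fixes f :: "'a::real_normed_vector \<Rightarrow> 'b::euclidean_space" and g :: "'b \<Rightarrow> 'c::real_normed_vector"
  shows "open S \<Longrightarrow> smooth_on S f \<Longrightarrow> smooth_on T g \<Longrightarrow> f ` S \<subseteq> T \<Longrightarrow> smooth_on S (\<lambda>x. g (f x))"
  unfolding smooth_on_def using Ck_on_compose by blast

section \<open>Smooth maps between manifolds\<close>

lemma smooth_atlas_iff:
  "smooth_atlas A \<longleftrightarrow>
    (\<forall>U \<phi>. (U, \<phi>) \<in> A \<longrightarrow> inj_on \<phi> U \<and> open (\<phi> ` U)) \<and>
    (\<forall>U \<phi> V \<psi>. (U, \<phi>) \<in> A \<longrightarrow> (V, \<psi>) \<in> A \<longrightarrow>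
        open (\<phi> ` (U \<inter> V)) \<and> smooth_on (\<phi> ` (U \<inter> V)) (\<psi> \<circ> inv_into U \<phi>))"
  unfolding smooth_atlas_def by (simp add: Ball_def split_paired_all)

lemma smooth_atlasD:
  assumes "smooth_atlas A" "(U, \<phi>) \<in> A"
  shows "inj_on \<phi> U" "open (\<phi> ` U)"
    and "(V, \<psi>) \<in> A \<Longrightarrow> open (\<phi> ` (U \<inter> V))"
    and "(V, \<psi>) \<in> A \<Longrightarrow> smooth_on (\<phi> ` (U \<inter> V)) (\<psi> \<circ> inv_into U \<phi>)"
  using assms unfolding smooth_atlas_iff by simp_all

lemma smooth_map_iff:
  "smooth_map A B f \<longleftrightarrow> (\<forall>p\<in>points A. \<exists>U \<phi> V \<psi> W. (U, \<phi>) \<in> A \<and> (V, \<psi>) \<in> B \<and> p \<in> W \<and> W \<subseteq> U \<and>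
      open (\<phi> ` W) \<and> f ` W \<subseteq> V \<and> smooth_on (\<phi> ` W) (\<psi> \<circ> f \<circ> inv_into U \<phi>))"
  unfolding smooth_map_def by (simp add: Bex_def split_paired_Ex)

lemma smooth_mapI:
  assumes "\<And>p. p \<in> points A \<Longrightarrow> \<exists>U \<phi> V \<psi> W. (U, \<phi>) \<in> A \<and> (V, \<psi>) \<in> B \<and> p \<in> W \<and> W \<subseteq> U \<and>
      open (\<phi> ` W) \<and> f ` W \<subseteq> V \<and> smooth_on (\<phi> ` W) (\<psi> \<circ> f \<circ> inv_into U \<phi>)"
  shows "smooth_map A B f"
  unfolding smooth_map_iff using assms by simp

lemma smooth_mapE:
  assumes "smooth_map A B f" "p \<in> points A"
  obtains U \<phi> V \<psi> W where "(U, \<phi>) \<in> A" "(V, \<psi>) \<in> B" "p \<in> W" "W \<subseteq> U"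
    "open (\<phi> ` W)" "f ` W \<subseteq> V" "smooth_on (\<phi> ` W) (\<psi> \<circ> f \<circ> inv_into U \<phi>)"
proof -
  from assms have "\<exists>U \<phi> V \<psi> W. (U, \<phi>) \<in> A \<and> (V, \<psi>) \<in> B \<and> p \<in> W \<and> W \<subseteq> U \<and>
      open (\<phi> ` W) \<and> f ` W \<subseteq> V \<and> smooth_on (\<phi> ` W) (\<psi> \<circ> f \<circ> inv_into U \<phi>)"
    unfolding smooth_map_iff by (rule bspec)
  then show thesis
    by (elim exE conjE) (rule that)
qed

lemma pointsI: "(U, \<phi>) \<in> A \<Longrightarrow> p \<in> U \<Longrightarrow> p \<in> points A"
  unfolding points_def by force

lemma pointsE:
  assumes "p \<in> points A"
  obtains U \<phi> where "(U, \<phi>) \<in> A" "p \<in> U"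
  using assms unfolding points_def by force

lemma points_vector_space_atlas [simp]: "points vector_space_atlas = UNIV"
  by (simp add: points_def vector_space_atlas_def)

lemma points_product_atlas [simp]: "points (product_atlas A B) = points A \<times> points B"
  unfolding points_def product_atlas_def by force

lemma product_atlasI:
  "(U, \<phi>) \<in> A \<Longrightarrow> (V, \<psi>) \<in> B \<Longrightarrow> (U \<times> V, map_prod \<phi> \<psi>) \<in> product_atlas A B"
  unfolding product_atlas_def by blast

lemma product_atlasE:
  assumes "(W, \<kappa>) \<in> product_atlas A B"
  obtains U \<phi> V \<psi> where "(U, \<phi>) \<in> A" "(V, \<psi>) \<in> B" "W = U \<times> V" "\<kappa> = map_prod \<phi> \<psi>"
  using assms unfolding product_atlas_def by blast

text \<open>Preimages under a local representative are chart images of subsets of the manifold. This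
  is how continuity in coordinates yields the openness of chart images that
  \<open>smooth_map\<close> asks for.\<close>

lemma image_Int_vimage_inv_into:
  assumes "inj_on \<phi> U" "W \<subseteq> U"
  shows "\<phi> ` W \<inter> (h \<circ> inv_into U \<phi>) -` T = \<phi> ` {x \<in> W. h x \<in> T}"
proof -
  have "inv_into U \<phi> (\<phi> x) = x" if "x \<in> W" for x
    using that assms by (auto simp: inv_into_f_f)
  then show ?thesis
    by auto
qed

text \<open>Openness seen in one chart carries over to every other: read in \<open>\<phi>\<close>,
  the set \<open>W \<inter> U\<close> is the preimage of an open set under the continuous transition
  function. This stands in for restricting charts of a maximal atlas.\<close>

lemma open_chart_image:
  assumes "smooth_atlas A" "(U, \<phi>) \<in> A" "(V, \<psi>) \<in> A" "W \<subseteq> V" "open (\<psi> ` W)"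
  shows "open (\<phi> ` (W \<inter> U))"
proof -
  have "open (\<phi> ` (U \<inter> V) \<inter> (\<psi> \<circ> inv_into U \<phi>) -` (\<psi> ` W))"
    by (intro continuous_open_preimage smooth_on_imp_continuous_on smooth_atlasD(3,4)[OF assms(1-3)] assms)
  also have "\<phi> ` (U \<inter> V) \<inter> (\<psi> \<circ> inv_into U \<phi>) -` (\<psi> ` W) = \<phi> ` {x \<in> U \<inter> V. \<psi> x \<in> \<psi> ` W}"
    by (rule image_Int_vimage_inv_into[OF smooth_atlasD(1)[OF assms(1,2)]]) auto
  also have "{x \<in> U \<inter> V. \<psi> x \<in> \<psi> ` W} = W \<inter> U"
    using assms(4) inj_on_image_mem_iff[OF smooth_atlasD(1)[OF assms(1,3)] _ assms(4)] by auto
  finally show ?thesis .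
qed

text \<open>The charts at \<open>f p\<close> supplied by \<open>f\<close> and by \<open>g\<close>
  may differ, so a transition function of \<open>B\<close> is inserted and the domain is shrunk to
  \<open>W''\<close>. The model space of \<open>B\<close> is the intermediate space of the chain
  rule, hence Euclidean.\<close>

lemma smooth_map_compose:
  fixes B :: "('b, 'f::euclidean_space) atlas"
  assumes A: "smooth_atlas A" and B: "smooth_atlas B"
    and f: "smooth_map A B f" and g: "smooth_map B C g" and fB: "f ` points A \<subseteq> points B"
  shows "smooth_map A C (\<lambda>x. g (f x))"
proof (rule smooth_mapI)
  fix p assume p: "p \<in> points A"
  obtain U \<phi> V \<psi> W where 1: "(U, \<phi>) \<in> A" "(V, \<psi>) \<in> B" "p \<in> W" "W \<subseteq> U"
    "open (\<phi> ` W)" "f ` W \<subseteq> V" "smooth_on (\<phi> ` W) (\<psi> \<circ> f \<circ> inv_into U \<phi>)"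
    using f p by (rule smooth_mapE)
  have "f p \<in> points B"
    using fB p by auto
  with g obtain V' \<psi>' Z \<kappa> W' where 2: "(V', \<psi>') \<in> B" "(Z, \<kappa>) \<in> C" "f p \<in> W'" "W' \<subseteq> V'"
    "open (\<psi>' ` W')" "g ` W' \<subseteq> Z" "smooth_on (\<psi>' ` W') (\<kappa> \<circ> g \<circ> inv_into V' \<psi>')"
    by (rule smooth_mapE)
  note inj = smooth_atlasD(1)[OF A 1(1)] smooth_atlasD(1)[OF B 1(2)] smooth_atlasD(1)[OF B 2(1)]
  note [simp] = inj[THEN inv_into_f_f]
  define W'' where "W'' = {x \<in> W. f x \<in> W'}"
  have "open (\<psi> ` (W' \<inter> V))"
    by (rule open_chart_image[OF B 1(2) 2(1,4,5)])
  then have "open (\<phi> ` W \<inter> (\<psi> \<circ> f \<circ> inv_into U \<phi>) -` (\<psi> ` (W' \<inter> V)))"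
    using 1(5) smooth_on_imp_continuous_on[OF 1(7)] by (intro continuous_open_preimage)
  also have "\<phi> ` W \<inter> (\<psi> \<circ> f \<circ> inv_into U \<phi>) -` (\<psi> ` (W' \<inter> V))
      = \<phi> ` {x \<in> W. (\<psi> \<circ> f) x \<in> \<psi> ` (W' \<inter> V)}"
    by (rule image_Int_vimage_inv_into[OF inj(1) 1(4)])
  also have "{x \<in> W. (\<psi> \<circ> f) x \<in> \<psi> ` (W' \<inter> V)} = W''"
    unfolding W''_def using 1(6) inj_on_image_mem_iff[OF inj(2), of _ "W' \<inter> V"]
    by (intro Collect_cong) auto
  finally have op: "open (\<phi> ` W'')" .
  have mem: "x \<in> U" "f x \<in> V" "f x \<in> V'" "f x \<in> W'" if "x \<in> W''" for x
    using that 1(4,6) 2(4) by (auto simp: W''_def)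
  have s1: "smooth_on (\<phi> ` W'') (\<lambda>z. \<psi> (f (inv_into U \<phi> z)))"
    using smooth_on_subset[OF 1(7), of "\<phi> ` W''"] by (auto simp: o_def W''_def)
  have s2: "smooth_on (\<phi> ` W'') (\<lambda>z. (\<psi>' \<circ> inv_into V \<psi>) (\<psi> (f (inv_into U \<phi> z))))"
    by (rule smooth_on_compose[OF op s1 smooth_atlasD(4)[OF B 1(2) 2(1)]]) (auto simp: mem)
  have s3: "smooth_on (\<phi> ` W'')
      (\<lambda>z. (\<kappa> \<circ> g \<circ> inv_into V' \<psi>') ((\<psi>' \<circ> inv_into V \<psi>) (\<psi> (f (inv_into U \<phi> z)))))"
    by (rule smooth_on_compose[OF op s2 2(7)]) (auto simp: mem)
  have "smooth_on (\<phi> ` W'') (\<kappa> \<circ> (\<lambda>x. g (f x)) \<circ> inv_into U \<phi>)"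
    by (rule smooth_on_cong[OF s3 op]) (auto simp: mem)
  moreover have "p \<in> W''" "W'' \<subseteq> U" "(\<lambda>x. g (f x)) ` W'' \<subseteq> Z"
    using 1 2 by (auto simp: W''_def)
  ultimately show "\<exists>U \<phi> V \<psi> W. (U, \<phi>) \<in> A \<and> (V, \<psi>) \<in> C \<and> p \<in> W \<and> W \<subseteq> U \<and>
      open (\<phi> ` W) \<and> (\<lambda>x. g (f x)) ` W \<subseteq> V \<and> smooth_on (\<phi> ` W) (\<psi> \<circ> (\<lambda>x. g (f x)) \<circ> inv_into U \<phi>)"
    using 1(1) 2(2) op by blast
qed

section \<open>Products of manifolds\<close>

lemma smooth_on_map_prod:
  assumes "open S" "open T" "smooth_on S f" "smooth_on T g"
  shows "smooth_on (S \<times> T) (map_prod f g)"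
proof -
  have "smooth_on (S \<times> T) (\<lambda>z. (f (fst z), g (snd z)))"
    by (intro smooth_on_Pair open_Times smooth_on_comp_linear[OF bounded_linear_fst _ assms(3)]
        smooth_on_comp_linear[OF bounded_linear_snd _ assms(4)] assms) auto
  then show ?thesis
    by (simp add: map_prod_def case_prod_unfold)
qed

lemma inv_into_map_prod:
  assumes "inj_on \<phi> U" "inj_on \<psi> V" "x \<in> \<phi> ` U" "y \<in> \<psi> ` V"
  shows "inv_into (U \<times> V) (map_prod \<phi> \<psi>) (x, y) = (inv_into U \<phi> x, inv_into V \<psi> y)"
  by (rule inv_into_f_eq) (use assms in \<open>auto simp: map_prod_inj_on\<close>)

lemma smooth_atlas_product:
  assumes "smooth_atlas A" "smooth_atlas B"
  shows "smooth_atlas (product_atlas A B)"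
proof -
  have 1: "inj_on \<kappa> W \<and> open (\<kappa> ` W)" if c: "(W, \<kappa>) \<in> product_atlas A B" for W \<kappa>
  proof -
    from c obtain U \<phi> V \<psi> where *: "(U, \<phi>) \<in> A" "(V, \<psi>) \<in> B" "W = U \<times> V" "\<kappa> = map_prod \<phi> \<psi>"
      by (rule product_atlasE)
    then show ?thesis
      using smooth_atlasD(1,2)[OF assms(1) *(1)] smooth_atlasD(1,2)[OF assms(2) *(2)]
      by (simp add: map_prod_inj_on map_prod_surj_on[OF refl refl] open_Times)
  qed
  have 2: "open (\<kappa> ` (W \<inter> W')) \<and> smooth_on (\<kappa> ` (W \<inter> W')) (\<kappa>' \<circ> inv_into W \<kappa>)"
    if c: "(W, \<kappa>) \<in> product_atlas A B" "(W', \<kappa>') \<in> product_atlas A B" for W \<kappa> W' \<kappa>'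
  proof -
    from c(1) obtain U \<phi> V \<psi> where *: "(U, \<phi>) \<in> A" "(V, \<psi>) \<in> B" "W = U \<times> V" "\<kappa> = map_prod \<phi> \<psi>"
      by (rule product_atlasE)
    from c(2) obtain U' \<phi>' V' \<psi>' where **: "(U', \<phi>') \<in> A" "(V', \<psi>') \<in> B"
        "W' = U' \<times> V'" "\<kappa>' = map_prod \<phi>' \<psi>'"
      by (rule product_atlasE)
    note a = smooth_atlasD[OF assms(1) *(1)] smooth_atlasD[OF assms(2) *(2)]
    have eq: "\<kappa> ` (W \<inter> W') = \<phi> ` (U \<inter> U') \<times> \<psi> ` (V \<inter> V')"
      unfolding * ** Times_Int_Times by (rule map_prod_surj_on) auto
    have op: "open (\<kappa> ` (W \<inter> W'))"
      unfolding eq using a ** by (intro open_Times) auto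
    have "smooth_on (\<phi> ` (U \<inter> U') \<times> \<psi> ` (V \<inter> V'))
        (map_prod (\<phi>' \<circ> inv_into U \<phi>) (\<psi>' \<circ> inv_into V \<psi>))"
      by (intro smooth_on_map_prod a(3,4)[OF **(1)] a(7,8)[OF **(2)])
    then have "smooth_on (\<kappa> ` (W \<inter> W')) (\<kappa>' \<circ> inv_into W \<kappa>)"
      unfolding eq by (rule smooth_on_cong)
        (use a op in \<open>auto simp: eq[symmetric] * ** inv_into_map_prod\<close>)
    with op show ?thesis by simp
  qed
  show ?thesis
    unfolding smooth_atlas_iff using 1 2 by simp
qed

lemma smooth_map_product:
  assumes A: "smooth_atlas A" "smooth_atlas B"
    and f: "smooth_map A C f" and g: "smooth_map B D g"
  shows "smooth_map (product_atlas A B) (product_atlas C D) (map_prod f g)"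
proof (rule smooth_mapI)
  fix p assume "p \<in> points (product_atlas A B)"
  then have p: "fst p \<in> points A" "snd p \<in> points B"
    by auto
  from f p(1) obtain U \<phi> V \<psi> W where 1: "(U, \<phi>) \<in> A" "(V, \<psi>) \<in> C" "fst p \<in> W" "W \<subseteq> U"
    "open (\<phi> ` W)" "f ` W \<subseteq> V" "smooth_on (\<phi> ` W) (\<psi> \<circ> f \<circ> inv_into U \<phi>)"
    by (rule smooth_mapE)
  from g p(2) obtain U' \<phi>' V' \<psi>' W' where 2: "(U', \<phi>') \<in> B" "(V', \<psi>') \<in> D" "snd p \<in> W'" "W' \<subseteq> U'"
    "open (\<phi>' ` W')" "g ` W' \<subseteq> V'" "smooth_on (\<phi>' ` W') (\<psi>' \<circ> g \<circ> inv_into U' \<phi>')"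
    by (rule smooth_mapE)
  note inj = smooth_atlasD(1)[OF A(1) 1(1)] smooth_atlasD(1)[OF A(2) 2(1)]
  have eq: "map_prod \<phi> \<phi>' ` (W \<times> W') = \<phi> ` W \<times> \<phi>' ` W'"
    by (rule map_prod_surj_on) auto
  have op: "open (\<phi> ` W \<times> \<phi>' ` W')"
    using 1 2 by (intro open_Times)
  have "smooth_on (\<phi> ` W \<times> \<phi>' ` W')
      (map_prod \<psi> \<psi>' \<circ> map_prod f g \<circ> inv_into (U \<times> U') (map_prod \<phi> \<phi>'))"
    by (rule smooth_on_cong[OF smooth_on_map_prod[OF 1(5) 2(5) 1(7) 2(7)] op])
      (use inj 1(4) 2(4) in \<open>auto simp: inv_into_map_prod subset_iff\<close>)
  then show "\<exists>U \<phi> V \<psi> W. (U, \<phi>) \<in> product_atlas A B \<and> (V, \<psi>) \<in> product_atlas C D \<and> p \<in> W \<and>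
      W \<subseteq> U \<and> open (\<phi> ` W) \<and> map_prod f g ` W \<subseteq> V \<and>
      smooth_on (\<phi> ` W) (\<psi> \<circ> map_prod f g \<circ> inv_into U \<phi>)"
    using 1 2 op eq product_atlasI[OF 1(1) 2(1)] product_atlasI[OF 1(2) 2(2)]
    by (intro exI[of _ "U \<times> U'"] exI[of _ "map_prod \<phi> \<phi>'"] exI[of _ "V \<times> V'"]
        exI[of _ "map_prod \<psi> \<psi>'"] exI[of _ "W \<times> W'"])
      (auto simp: mem_Times_iff)
qed

section \<open>Smooth maps from and to vector spaces\<close>

lemma smooth_atlas_vector_space: "smooth_atlas vector_space_atlas"
  using smooth_on_bounded_linear[OF bounded_linear_ident]
  by (auto simp: smooth_atlas_def vector_space_atlas_def  o_def id_def)

lemma product_vector_space_atlas: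
  "product_atlas vector_space_atlas vector_space_atlas = vector_space_atlas"
  by (auto simp: product_atlas_def vector_space_atlas_def)

lemma smooth_map_vector_space_iff:
  "smooth_map vector_space_atlas vector_space_atlas f \<longleftrightarrow> smooth_on UNIV f"
proof
  assume "smooth_map vector_space_atlas vector_space_atlas f"
  then show "smooth_on UNIV f"
    by (intro smooth_on_local) (fastforce simp: smooth_map_def vector_space_atlas_def points_def )
next
  assume "smooth_on UNIV f"
  then show "smooth_map vector_space_atlas vector_space_atlas f"
    by (auto simp: smooth_map_def vector_space_atlas_def points_def  intro!: exI[of _ UNIV])
qed


lemma openin_preimage_smooth_map:
  assumes A: "smooth_atlas A" and f: "smooth_map vector_space_atlas A f"
    and T: "openin (manifold_topology A) T"
  shows "open (f -` T)"
proof (subst open_subopen, intro ballI)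
  fix x assume x: "x \<in> f -` T"
  have "x \<in> points vector_space_atlas" by simp
  with f obtain U \<phi> V \<psi> W where 1: "(U, \<phi>) \<in> vector_space_atlas" "(V, \<psi>) \<in> A" "x \<in> W" "W \<subseteq> U"
    "open (\<phi> ` W)" "f ` W \<subseteq> V" "smooth_on (\<phi> ` W) (\<psi> \<circ> f \<circ> inv_into U \<phi>)"
    by (rule smooth_mapE)
  then have W: "open W" "continuous_on W (\<psi> \<circ> f)"
    using smooth_on_imp_continuous_on[OF 1(7)] by (auto simp: vector_space_atlas_def)
  have "open (\<psi> ` (T \<inter> V))"
    using T 1(2) unfolding openin_manifold_topology[OF A] by auto
  with W have "open (W \<inter> (\<psi> \<circ> f) -` (\<psi> ` (T \<inter> V)))"
    by (intro continuous_open_preimage)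
  moreover have "W \<inter> (\<psi> \<circ> f) -` (\<psi> ` (T \<inter> V)) = W \<inter> f -` T"
    using 1(6) inj_on_image_mem_iff[OF smooth_atlasD(1)[OF A 1(2)], of _ "T \<inter> V"]
    unfolding vimage_def Int_def by (intro Collect_cong) auto
  ultimately show "\<exists>S. open S \<and> x \<in> S \<and> S \<subseteq> f -` T"
    using x 1(3) by (metis IntI Int_lower2)
qed

text \<open>\<open>smooth_map\<close> only promises some chart near each point. The transition
  functions transfer smoothness to a prescribed chart, and locality glues the pieces over its whole
  domain.\<close>

lemma smooth_map_imp_smooth_on_chart:
  fixes A :: "('a, 'e::euclidean_space) atlas"
  assumes A: "smooth_atlas A" and c: "(U, \<phi>) \<in> A" and f: "smooth_map A vector_space_atlas f"
  shows "smooth_on (\<phi> ` U) (f \<circ> inv_into U \<phi>)"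
proof (rule smooth_on_local)
  fix s assume "s \<in> \<phi> ` U"
  then obtain p where p: "p \<in> U" "s = \<phi> p" by auto
  from f pointsI[OF c p(1)] obtain U' \<phi>' V \<psi> W where 1: "(U', \<phi>') \<in> A" "(V, \<psi>) \<in> vector_space_atlas"
    "p \<in> W" "W \<subseteq> U'" "open (\<phi>' ` W)" "f ` W \<subseteq> V" "smooth_on (\<phi>' ` W) (\<psi> \<circ> f \<circ> inv_into U' \<phi>')"
    by (rule smooth_mapE)
  have f': "smooth_on (\<phi>' ` W) (f \<circ> inv_into U' \<phi>')"
    using 1(2,7) by (simp add: vector_space_atlas_def)
  have op: "open (\<phi> ` (W \<inter> U))"
    by (rule open_chart_image[OF A c 1(1,4,5)])
  have sub: "\<phi> ` (W \<inter> U) \<subseteq> \<phi> ` (U \<inter> U')"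
    using 1(4) by auto
  note [simp] = smooth_atlasD(1)[OF A c, THEN inv_into_f_f] smooth_atlasD(1)[OF A 1(1), THEN inv_into_f_f]
  have "smooth_on (\<phi> ` (W \<inter> U)) (\<lambda>s. (f \<circ> inv_into U' \<phi>') ((\<phi>' \<circ> inv_into U \<phi>) s))"
    by (rule smooth_on_compose[OF op smooth_on_subset[OF smooth_atlasD(4)[OF A c 1(1)] sub] f']) auto
  then have "smooth_on (\<phi> ` (W \<inter> U)) (f \<circ> inv_into U \<phi>)"
    by (rule smooth_on_cong[OF _ op]) (use 1(4) in \<open>auto simp: subset_iff\<close>)
  then show "\<exists>T. open T \<and> s \<in> T \<and> smooth_on T (f \<circ> inv_into U \<phi>)"
    using op p 1(3) by blast
qed

section \<open>Actions on cosets and semidirect products\<close>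

text \<open>The action is right multiplication by the inverse on \<open>K\<close>-cosets \<open>K a\<close>, transported along \<open>\<Psi>\<close>.\<close>

lemma coset_action_exists:
  assumes "group H" and K: "subgroup K H" and X: "\<Psi> ` carrier H = X"
    and \<Psi>: "\<And>a b. a \<in> carrier H \<Longrightarrow> b \<in> carrier H \<Longrightarrow>
      \<Psi> a = \<Psi> b \<longleftrightarrow> (\<exists>k\<in>K. b = k \<otimes>\<^bsub>H\<^esub> a)"
  obtains \<Phi> where "transitive_action H X \<Phi>"
    and "\<forall>h\<in>carrier H. \<forall>a\<in>carrier H. \<Phi> h (\<Psi> a) = \<Psi> (a \<otimes>\<^bsub>H\<^esub> inv\<^bsub>H\<^esub> h)"
    and "stabilizer H \<Phi> (\<Psi> \<one>\<^bsub>H\<^esub>) = K"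
proof -
  interpret group H by fact
  have KH: "K \<subseteq> carrier H"
    using K by (rule subgroup.subset)
  define s where "s x = inv_into (carrier H) \<Psi> x" for x
  \<comment> \<open>\<open>s\<close> is an arbitrary choice of representatives, harmless because
    left multiplication by \<open>K\<close> commutes with right multiplication. The restriction to
    \<open>X\<close> makes \<open>\<Phi> h\<close> extensional, as membership in
    \<open>Bij X\<close> demands.\<close>
  define \<Phi> where "\<Phi> h = (\<lambda>x\<in>X. \<Psi> (s x \<otimes>\<^bsub>H\<^esub> inv\<^bsub>H\<^esub> h))" for h
  have s: "s x \<in> carrier H" "\<Psi> (s x) = x" if "x \<in> X" for x
    using that X by (auto simp: s_def inv_into_into f_inv_into_f)
  have mem: "\<Psi> a \<in> X" if "a \<in> carrier H" for a
    using that X by auto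
  have \<Phi>: "\<Phi> h (\<Psi> a) = \<Psi> (a \<otimes>\<^bsub>H\<^esub> inv\<^bsub>H\<^esub> h)" if h: "h \<in> carrier H" and a: "a \<in> carrier H" for h a
  proof -
    have "\<Psi> (s (\<Psi> a)) = \<Psi> a"
      using s(2)[OF mem[OF a]] .
    then obtain k where k: "k \<in> K" "a = k \<otimes>\<^bsub>H\<^esub> s (\<Psi> a)"
      using \<Psi>[OF s(1)[OF mem[OF a]] a] by blast
    then have "a \<otimes>\<^bsub>H\<^esub> inv\<^bsub>H\<^esub> h = k \<otimes>\<^bsub>H\<^esub> (s (\<Psi> a) \<otimes>\<^bsub>H\<^esub> inv\<^bsub>H\<^esub> h)"
      using KH h s(1)[OF mem[OF a]] by (metis inv_closed m_assoc subsetD)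
    moreover have "s (\<Psi> a) \<otimes>\<^bsub>H\<^esub> inv\<^bsub>H\<^esub> h \<in> carrier H" "a \<otimes>\<^bsub>H\<^esub> inv\<^bsub>H\<^esub> h \<in> carrier H"
      using h a s(1)[OF mem[OF a]] by auto
    ultimately have "\<Psi> (s (\<Psi> a) \<otimes>\<^bsub>H\<^esub> inv\<^bsub>H\<^esub> h) = \<Psi> (a \<otimes>\<^bsub>H\<^esub> inv\<^bsub>H\<^esub> h)"
      using \<Psi>[THEN iffD2] k(1) by blast
    then show ?thesis
      using mem[OF a] by (simp add: \<Phi>_def)
  qed
  have comp: "\<Phi> (g \<otimes>\<^bsub>H\<^esub> h) x = \<Phi> g (\<Phi> h x)" if gh: "g \<in> carrier H" "h \<in> carrier H" "x \<in> X" for g h x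
  proof -
    obtain a where "a \<in> carrier H" "x = \<Psi> a"
      using X gh(3) by auto
    then show ?thesis
      using gh by (simp add: \<Phi> inv_mult_group m_assoc)
  qed
  have closed: "\<Phi> h x \<in> X" if "h \<in> carrier H" "x \<in> X" for h x
    using that s(1) by (simp add: \<Phi>_def mem)
  have one: "\<Phi> \<one>\<^bsub>H\<^esub> x = x" if "x \<in> X" for x
    using that s by (simp add: \<Phi>_def)
  have bij: "\<Phi> h \<in> Bij X" if h: "h \<in> carrier H" for h
  proof -
    have "bij_betw (\<Phi> h) X X"
      by (rule bij_betwI[where g = "\<Phi> (inv\<^bsub>H\<^esub> h)"])
        (use h closed comp[symmetric] one in auto)
    then show ?thesis
      by (simp add: Bij_def \<Phi>_def)
  qed
  have "transitive_action H X \<Phi>"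
  proof (intro transitive_action.intro group_action.intro transitive_action_axioms.intro)
    have "\<Phi> (g \<otimes>\<^bsub>H\<^esub> h) = compose X (\<Phi> g) (\<Phi> h)" if "g \<in> carrier H" "h \<in> carrier H" for g h
      unfolding compose_def by (rule ext) (use that comp in \<open>auto simp: restrict_def \<Phi>_def\<close>)
    then have "\<Phi> \<in> hom H (BijGroup X)"
      by (intro homI) (auto simp: BijGroup_def bij)
    then show "group_hom H (BijGroup X) \<Phi>"
      by (intro group_hom.intro group_hom_axioms.intro group_BijGroup is_group)
    fix x y assume "x \<in> X" "y \<in> X"
    then obtain a b where ab: "a \<in> carrier H" "x = \<Psi> a" "b \<in> carrier H" "y = \<Psi> b"
      using X by auto
    have "\<Phi> (inv\<^bsub>H\<^esub> b \<otimes>\<^bsub>H\<^esub> a) x = \<Psi> (a \<otimes>\<^bsub>H\<^esub> (inv\<^bsub>H\<^esub> a \<otimes>\<^bsub>H\<^esub> b))"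
      using ab by (simp add: \<Phi> inv_mult_group)
    also have "\<dots> = y"
      using ab by (simp add: m_assoc[symmetric])
    finally show "\<exists>g\<in>carrier H. \<Phi> g x = y"
      using ab by (intro bexI[of _ "inv\<^bsub>H\<^esub> b \<otimes>\<^bsub>H\<^esub> a"]) auto
  qed
  moreover have "stabilizer H \<Phi> (\<Psi> \<one>\<^bsub>H\<^esub>) = K"
  proof -
    have "\<Phi> h (\<Psi> \<one>\<^bsub>H\<^esub>) = \<Psi> \<one>\<^bsub>H\<^esub> \<longleftrightarrow> h \<in> K" if h: "h \<in> carrier H" for h
    proof -
      have "\<Phi> h (\<Psi> \<one>\<^bsub>H\<^esub>) = \<Psi> \<one>\<^bsub>H\<^esub> \<longleftrightarrow> (\<exists>k\<in>K. \<one>\<^bsub>H\<^esub> = k \<otimes>\<^bsub>H\<^esub> inv\<^bsub>H\<^esub> h)"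
        using h by (simp add: \<Phi> \<Psi>)
      also have "\<dots> \<longleftrightarrow> h \<in> K"
        using KH h by (metis inv_closed inv_equality inv_inv r_inv subsetD)
      finally show ?thesis .
    qed
    then show ?thesis
      using KH by (auto simp: stabilizer_def)
  qed
  ultimately show thesis
    using \<Phi> by (intro that) auto
qed

lemma semidirect_simps [simp]:
  "carrier (semidirect G \<sigma> V) = carrier G \<times> V"
  "\<one>\<^bsub>semidirect G \<sigma> V\<^esub> = (\<one>\<^bsub>G\<^esub>, 0)"
  "(g', y') \<otimes>\<^bsub>semidirect G \<sigma> V\<^esub> (g, y) = (g' \<otimes>\<^bsub>G\<^esub> g, y' + \<sigma> g' y)"
  by (simp_all add: semidirect_def)

locale additive_representation = group G for G (structure) +
  fixes \<sigma> :: "'a \<Rightarrow> 'v::ab_group_add \<Rightarrow> 'v"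
  assumes rep_add: "g \<in> carrier G \<Longrightarrow> \<sigma> g (x + y) = \<sigma> g x + \<sigma> g y"
    and rep_mult: "g \<in> carrier G \<Longrightarrow> h \<in> carrier G \<Longrightarrow> \<sigma> (g \<otimes> h) x = \<sigma> g (\<sigma> h x)"
    and rep_one: "\<sigma> \<one> x = x"
begin

lemma rep_zero: "g \<in> carrier G \<Longrightarrow> \<sigma> g 0 = 0"
  using rep_add[of g 0 0] by simp

lemma rep_minus: "g \<in> carrier G \<Longrightarrow> \<sigma> g (- x) = - \<sigma> g x"
  using rep_add[of g x "- x"] rep_zero by (simp add: eq_neg_iff_add_eq_0 add.commute)

lemma group_semidirect: "group (semidirect G \<sigma> UNIV)"
proof (rule groupI)
  fix x assume "x \<in> carrier (semidirect G \<sigma> UNIV)"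
  then show "\<exists>y\<in>carrier (semidirect G \<sigma> UNIV). y \<otimes>\<^bsub>semidirect G \<sigma> UNIV\<^esub> x = \<one>\<^bsub>semidirect G \<sigma> UNIV\<^esub>"
    by (intro bexI[of _ "(inv fst x, - \<sigma> (inv fst x) (snd x))"]) (auto simp: rep_one)
qed (auto simp: m_assoc rep_add rep_mult rep_one add.assoc)

lemma inv_semidirect:
  assumes "g \<in> carrier G"
  shows "inv\<^bsub>semidirect G \<sigma> UNIV\<^esub> (g, y) = (inv g, - \<sigma> (inv g) y)"
  by (rule group.inv_equality[OF group_semidirect]) (use assms in auto)

lemma subgroup_semidirect:
  assumes \<Gamma>: "subgroup \<Gamma> G" and M: "0 \<in> M" "\<And>x y. x \<in> M \<Longrightarrow> y \<in> M \<Longrightarrow> x + y \<in> M" "\<And>x. x \<in> M \<Longrightarrow> - x \<in> M"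
    and \<sigma>: "\<And>g x. g \<in> \<Gamma> \<Longrightarrow> x \<in> M \<Longrightarrow> \<sigma> g x \<in> M"
  shows "subgroup (\<Gamma> \<times> M) (semidirect G \<sigma> UNIV)"
proof -
  note s = subgroup.mem_carrier[OF \<Gamma>] subgroup.m_closed[OF \<Gamma>] subgroup.m_inv_closed[OF \<Gamma>]
    subgroup.one_closed[OF \<Gamma>]
  show ?thesis
    by (rule subgroup.intro) (use assms s in \<open>auto simp: inv_semidirect\<close>)
qed

end

section \<open>Complete left-invariant affine structures\<close>

locale integral_affine_quotient =
  fixes G :: "('g, 'm) monoid_scheme" (structure)
    and A :: "('g, real ^ 'n) atlas" and D :: "'g \<Rightarrow> real ^ 'n" and \<Gamma> :: "'g set"
  assumes lie: "lie_group G A"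
    and complete: "complete_left_invariant_affine_structure G A D"
    and D_one: "D \<one> = 0"
    and lattice: "lattice_in \<Gamma> G A"
    and integral: "\<forall>\<gamma>\<in>\<Gamma>. linear_rep G D \<gamma> \<in> GL_int"
begin

sublocale group G
  using lie by (simp add: lie_group_def)

abbreviation Dinv :: "real ^ 'n \<Rightarrow> 'g" where
  "Dinv \<equiv> inv_into (carrier G) D"

abbreviation pr :: "'g \<Rightarrow> 'g set" where
  "pr \<equiv> \<lambda>h. \<Gamma> #> h"

abbreviation \<rho> :: "'g \<Rightarrow> real ^ 'n \<Rightarrow> real ^ 'n" where
  "\<rho> \<equiv> rep_action G D"

lemma atlas: "smooth_atlas A" "points A = carrier G"
  using lie by (auto simp: lie_group_def smooth_manifold_def)

lemma subgroup_\<Gamma>: "subgroup \<Gamma> G"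
  using lattice by (simp add: lattice_in_def)

lemma \<Gamma>_closed [simp]: "\<gamma> \<in> \<Gamma> \<Longrightarrow> \<gamma> \<in> carrier G"
  using subgroup.mem_carrier[OF subgroup_\<Gamma>] .

lemma \<Gamma>_subset: "\<Gamma> \<subseteq> carrier G"
  by auto

lemma bij_D: "bij_betw D (carrier G) UNIV"
  using complete by (simp add: complete_left_invariant_affine_structure_def)

lemma Dinv_closed [simp]: "Dinv x \<in> carrier G"
  using bij_D by (metis UNIV_I bij_betw_def inv_into_into)

lemma D_Dinv [simp]: "D (Dinv x) = x"
  using bij_D by (simp add: bij_betw_inv_into_right)

lemma Dinv_D [simp]: "h \<in> carrier G \<Longrightarrow> Dinv (D h) = h"
  using bij_D by (simp add: bij_betw_inv_into_left)

lemma inj_D: "inj_on D (carrier G)"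
  using bij_D by (simp add: bij_betw_def)

lemma Dinv_zero [simp]: "Dinv 0 = \<one>"
  using Dinv_D[OF one_closed] by (simp add: D_one)

lemma smooth_D: "smooth_map A vector_space_atlas D"
  and smooth_Dinv: "smooth_map vector_space_atlas A Dinv"
  using complete by (simp_all add: complete_left_invariant_affine_structure_def)

text \<open>Multiplication written in the global coordinates \<open>D\<close>. This and
  \<open>smooth_on_inv\<close> are the sources of smoothness for the representation and for the
  action.\<close>

lemma smooth_on_mult: "smooth_on UNIV (\<lambda>z. D (Dinv (fst z) \<otimes> Dinv (snd z)))"
proof -
  have "smooth_map (product_atlas vector_space_atlas vector_space_atlas) (product_atlas A A)
      (map_prod Dinv Dinv)"
    by (intro smooth_map_product smooth_atlas_vector_space smooth_Dinv)
  moreover have "smooth_map (product_atlas A A) A (\<lambda>(g, h). g \<otimes> h)"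
    using lie by (simp add: lie_group_def)
  then have "smooth_map (product_atlas A A) vector_space_atlas (\<lambda>z. D ((\<lambda>(g, h). g \<otimes> h) z))"
    by (rule smooth_map_compose[OF smooth_atlas_product[OF atlas(1) atlas(1)] atlas(1) _ smooth_D])
      (auto simp: atlas)
  ultimately have "smooth_map (product_atlas vector_space_atlas vector_space_atlas) vector_space_atlas
      (\<lambda>z. D ((\<lambda>(g, h). g \<otimes> h) (map_prod Dinv Dinv z)))"
    by (intro smooth_map_compose[of _ "product_atlas A A" "map_prod Dinv Dinv"
          _ "\<lambda>z. D ((\<lambda>(g, h). g \<otimes> h) z)"] smooth_atlas_product smooth_atlas_vector_space atlas)
      (auto simp: atlas)
  then show ?thesis
    by (simp add: product_vector_space_atlas smooth_map_vector_space_iff map_prod_def case_prod_unfold)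
qed

lemma smooth_on_inv: "smooth_on UNIV (\<lambda>x. D (inv Dinv x))"
proof -
  have "smooth_map A A (\<lambda>g. inv g)"
    using lie by (simp add: lie_group_def)
  then have "smooth_map A vector_space_atlas (\<lambda>g. D (inv g))"
    by (rule smooth_map_compose[OF atlas(1) atlas(1) _ smooth_D]) (auto simp: atlas)
  then have "smooth_map vector_space_atlas vector_space_atlas (\<lambda>x. D (inv Dinv x))"
    by (rule smooth_map_compose[OF smooth_atlas_vector_space atlas(1) smooth_Dinv]) (auto simp: atlas)
  then show ?thesis
    by (simp add: smooth_map_vector_space_iff)
qed

text \<open>An affine map minus its value at 0 is its linear part, so the matrix in
  \<open>linear_rep\<close> represents \<open>T\<close>. Since \<open>Dinv 0 = \<one>\<close>, the
  value at 0 is \<open>D g\<close>; the resulting formula expresses \<rho> through the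
  multiplication of \<open>G\<close>, which is why \<rho> depends smoothly on
  \<open>g\<close>.\<close>

lemma linear_\<rho>: "g \<in> carrier G \<Longrightarrow> linear (\<rho> g)"
  and \<rho>_eq: "g \<in> carrier G \<Longrightarrow> \<rho> g y = D (g \<otimes> Dinv y) - D g"
proof -
  assume g: "g \<in> carrier G"
  then obtain T b where T: "linear T" "\<And>x. affine_rep G D g x = T x + b"
    using complete unfolding complete_left_invariant_affine_structure_def affine_transformation_def by blast
  have "(\<lambda>x. affine_rep G D g x - affine_rep G D g 0) = T"
    using T linear_0[OF T(1)] by auto
  moreover have "\<rho> g y = matrix T *v y" for y
    using calculation by (simp add: rep_action_def linear_rep_def)
  ultimately have *: "\<rho> g y = T y" "\<rho> g y = affine_rep G D g y - affine_rep G D g 0" for y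
    using T(1) by (auto simp: matrix_works)
  then have "\<rho> g = T" by auto
  then show "linear (\<rho> g)" using T(1) by simp
  show "\<rho> g y = D (g \<otimes> Dinv y) - D g"
    using g by (simp add: *(2) affine_rep_def)
qed

text \<open>In other words, \<open>D\<close> is a crossed homomorphism for \<rho>; the homomorphism
  property of \<rho> is derived from it.\<close>

lemma D_mult: "g \<in> carrier G \<Longrightarrow> h \<in> carrier G \<Longrightarrow> D (g \<otimes> h) = D g + \<rho> g (D h)"
  by (simp add: \<rho>_eq)

lemma \<rho>_mult:
  assumes "g \<in> carrier G" "h \<in> carrier G"
  shows "\<rho> (g \<otimes> h) y = \<rho> g (\<rho> h y)"
proof -
  have "\<rho> (g \<otimes> h) y = D (g \<otimes> (h \<otimes> Dinv y)) - D (g \<otimes> h)"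
    using assms by (simp add: \<rho>_eq m_assoc)
  also have "\<dots> = \<rho> g (D (h \<otimes> Dinv y)) - \<rho> g (D h)"
    using assms by (simp add: D_mult)
  also have "\<dots> = \<rho> g (\<rho> h y)"
    using assms by (simp add: \<rho>_eq[OF assms(2)] linear_diff[OF linear_\<rho>])
  finally show ?thesis .
qed

lemma \<rho>_one [simp]: "\<rho> \<one> y = y"
  by (simp add: \<rho>_eq D_one)

lemma \<rho>_inv_cancel [simp]:
  assumes "g \<in> carrier G"
  shows "\<rho> g (\<rho> (inv g) y) = y" "\<rho> (inv g) (\<rho> g y) = y"
  using assms by (simp_all add: \<rho>_mult[symmetric])

lemma bounded_linear_\<rho>: "g \<in> carrier G \<Longrightarrow> bounded_linear (\<rho> g)"
  using linear_\<rho> by (simp add: linear_conv_bounded_linear)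

lemma \<rho>_int_vectors:
  assumes "\<gamma> \<in> \<Gamma>" "v \<in> int_vectors"
  shows "\<rho> \<gamma> v \<in> int_vectors"
proof -
  have "linear_rep G D \<gamma> $ i $ j \<in> \<int>" for i j
    using integral assms(1) by (auto simp: GL_int_def)
  then show ?thesis
    using assms(2)
    by (auto simp: int_vectors_def rep_action_def matrix_vector_mult_def intro!: Ints_sum Ints_mult)
qed

text \<open>The local affine coordinates are the maps \<open>D \<circ> (pr|U)\<inverse>\<close> for \<open>good U\<close>.\<close>

definition good :: "'g set \<Rightarrow> bool" where
  "good U \<longleftrightarrow> U \<subseteq> carrier G \<and> open (D ` U) \<and> inj_on pr U"

lemma pr_eq_iff:
  assumes "h \<in> carrier G" "k \<in> carrier G"
  shows "pr h = pr k \<longleftrightarrow> (\<exists>\<gamma>\<in>\<Gamma>. k = \<gamma> \<otimes> h)"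
proof
  assume "pr h = pr k"
  moreover have "k \<in> pr k"
    using subgroup.one_closed[OF subgroup_\<Gamma>] assms by (force simp: r_coset_def)
  ultimately show "\<exists>\<gamma>\<in>\<Gamma>. k = \<gamma> \<otimes> h"
    by (auto simp: r_coset_def)
next
  assume "\<exists>\<gamma>\<in>\<Gamma>. k = \<gamma> \<otimes> h"
  then show "pr h = pr k"
    using assms repr_independence[OF _ _ subgroup_\<Gamma>, of k h] by (force simp: r_coset_def)
qed

lemma pr_mult_\<Gamma> [simp]: "h \<in> carrier G \<Longrightarrow> \<gamma> \<in> \<Gamma> \<Longrightarrow> pr (\<gamma> \<otimes> h) = pr h"
  using pr_eq_iff[of h "\<gamma> \<otimes> h"] by auto

text \<open>Discreteness gives a neighbourhood \<open>T\<close> of \<open>\<one>\<close> with \<open>T \<inter> \<Gamma> = {\<one>}\<close>; any \<open>U\<close> with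
  \<open>U U\<inverse> \<subseteq> T\<close> is good.\<close>

lemma good_exists:
  assumes h: "h \<in> carrier G"
  obtains U where "good U" "h \<in> U"
proof -
  have "openin (subtopology (manifold_topology A) \<Gamma>) {\<one>}"
    using lattice subgroup.one_closed[OF subgroup_\<Gamma>] by (simp add: lattice_in_def)
  then obtain T where T: "openin (manifold_topology A) T" "{\<one>} = T \<inter> \<Gamma>"
    by (auto simp: openin_subtopology)
  define d where "d z = D (Dinv (fst z) \<otimes> inv Dinv (snd z))" for z
  have "smooth_on UNIV (\<lambda>z. (fst z, D (inv Dinv (snd z))))"
    by (intro smooth_on_Pair smooth_on_bounded_linear[OF bounded_linear_fst]
        smooth_on_compose[OF _ smooth_on_bounded_linear[OF bounded_linear_snd] smooth_on_inv]) auto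
  then have "smooth_on UNIV (\<lambda>z. (\<lambda>z. D (Dinv (fst z) \<otimes> Dinv (snd z))) (fst z, D (inv Dinv (snd z))))"
    by (intro smooth_on_compose[OF _ _ smooth_on_mult]) auto
  then have "continuous_on UNIV d"
    using smooth_on_imp_continuous_on by (simp add: d_def[abs_def])
  then have "open (d -` (Dinv -` T))"
    using openin_preimage_smooth_map[OF atlas(1) smooth_Dinv T(1)] by (rule open_vimage[rotated])
  moreover have "(D h, D h) \<in> d -` (Dinv -` T)"
    using h T(2) by (auto simp: d_def D_one)
  ultimately obtain S S' where S: "open S" "open S'" "D h \<in> S" "D h \<in> S'" "S \<times> S' \<subseteq> d -` (Dinv -` T)"
    by (rule open_prod_elim) auto
  \<comment> \<open>\<open>S \<times> S'\<close> is a box around the diagonal point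
    \<open>(D h, D h)\<close>; the intersection makes every pair of elements of \<open>U\<close> lie
    in it, in either order.\<close>
  define U where "U = Dinv ` (S \<inter> S')"
  have "inj_on pr U"
  proof (rule inj_onI)
    fix a b assume a: "a \<in> U" "b \<in> U" "pr a = pr b"
    then have ab: "a \<in> carrier G" "b \<in> carrier G" "D a \<in> S" "D b \<in> S'"
      by (auto simp: U_def)
    then obtain \<gamma> where \<gamma>: "\<gamma> \<in> \<Gamma>" "a = \<gamma> \<otimes> b"
      using a(3) pr_eq_iff by metis
    have "(D a, D b) \<in> d -` (Dinv -` T)"
      using S(5) ab by blast
    then have "a \<otimes> inv b \<in> T"
      using ab by (simp add: d_def)
    moreover have "a \<otimes> inv b = \<gamma>"
      using \<gamma> ab by (simp add: m_assoc)
    ultimately have "\<gamma> = \<one>"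
      using T(2) \<gamma>(1) by auto
    then show "a = b"
      using \<gamma> ab by simp
  qed
  moreover have "D ` U = S \<inter> S'"
    by (force simp: U_def image_image)
  moreover have "h \<in> U"
    unfolding U_def using S h by (intro image_eqI[of _ _ "D h"]) auto
  ultimately show thesis
    using S by (intro that[of U]) (auto simp: good_def U_def)
qed

end

section \<open>Torus bundles as coset spaces\<close>

text \<open>The two torus bundles are treated uniformly: \<open>\<Theta>\<close> trivializes the pulled-back vector bundle
  over \<open>G\<close>, \<open>q\<close> is the fibrewise quotient, and the total space is \<open>(\<Gamma> \<times> M)\<close>-cosets of \<open>G \<times> V\<close>.\<close>

locale torus_bundle =
  integral_affine_quotient G A D \<Gamma> + additive_representation G \<sigma>
  for G :: "('g, 'm) monoid_scheme" (structure) and A :: "('g, real ^ 'n) atlas" and D \<Gamma>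
    and \<sigma> :: "'g \<Rightarrow> 'v::real_normed_vector \<Rightarrow> 'v" +
  fixes R :: "real ^ 'n \<Rightarrow> 'v \<Rightarrow>\<^sub>L 'v" and M :: "'v set" and \<epsilon> :: real
    and EA :: "('e, (real ^ 'n) \<times> 'v) atlas" and \<Theta> :: "'g \<times> 'v \<Rightarrow> 'e" and q :: "'e \<Rightarrow> 'x"
  assumes smooth_R: "smooth_on UNIV R"
    and R: "blinfun_apply (R x) y = \<sigma> (Dinv x) y"
    and M_zero: "0 \<in> M" and M_add: "\<And>x y. x \<in> M \<Longrightarrow> y \<in> M \<Longrightarrow> x + y \<in> M"
    and M_minus: "\<And>x. x \<in> M \<Longrightarrow> - x \<in> M"
    and M_invariant: "\<And>\<gamma> x. \<gamma> \<in> \<Gamma> \<Longrightarrow> x \<in> M \<Longrightarrow> \<sigma> \<gamma> x \<in> M"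
    and \<epsilon>_pos: "\<epsilon> > 0" and M_discrete: "\<And>x. x \<in> M \<Longrightarrow> norm x < \<epsilon> \<Longrightarrow> x = 0"
    and chart_exists: "good U \<Longrightarrow> \<exists>\<kappa>. (\<Theta> ` (U \<times> UNIV), \<kappa>) \<in> EA \<and> (\<forall>h\<in>U. \<forall>v. \<kappa> (\<Theta> (h, v)) = (D h, v))"
    and chart_domains: "(W, \<kappa>) \<in> EA \<Longrightarrow> W \<subseteq> \<Theta> ` (carrier G \<times> UNIV)"
    and q_eq_iff: "h \<in> carrier G \<Longrightarrow> h' \<in> carrier G \<Longrightarrow>
      q (\<Theta> (h, v)) = q (\<Theta> (h', v')) \<longleftrightarrow> (\<exists>\<gamma>\<in>\<Gamma>. \<exists>m\<in>M. h' = \<gamma> \<otimes> h \<and> v' = m + \<sigma> \<gamma> v)"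
begin

abbreviation \<Psi> :: "'g \<times> 'v \<Rightarrow> 'x" where
  "\<Psi> z \<equiv> q (\<Theta> z)"

text \<open>Two points over \<open>U \<times> ball w (\<epsilon> / 2)\<close> with the same class
  differ by some \<gamma> and \<open>m\<close>. Goodness of \<open>U\<close> makes their base points
  equal, cancellation gives \<gamma> = 1, and then \<open>m\<close> is a difference of two points of
  the ball, so its norm is below \<open>\<epsilon>\<close> and \<open>m = 0\<close>.\<close>

lemma torus_chart_exists:
  assumes U: "good U"
  obtains \<xi> where "(\<Psi> ` (U \<times> ball w (\<epsilon> / 2)), \<xi>) \<in> quotient_atlas EA q"
    and "\<And>h v. h \<in> U \<Longrightarrow> v \<in> ball w (\<epsilon> / 2) \<Longrightarrow> \<xi> (\<Psi> (h, v)) = (D h, v)"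
proof -
  obtain \<kappa> where \<kappa>: "(\<Theta> ` (U \<times> UNIV), \<kappa>) \<in> EA" "\<And>h v. h \<in> U \<Longrightarrow> \<kappa> (\<Theta> (h, v)) = (D h, v)"
    using chart_exists[OF U] by blast
  have U': "U \<subseteq> carrier G" "open (D ` U)" "inj_on pr U"
    using U by (auto simp: good_def)
  define N where "N = \<Theta> ` (U \<times> ball w (\<epsilon> / 2))"
  have inj: "inj_on q N"
  proof (rule inj_onI)
    fix a b assume "a \<in> N" "b \<in> N" and eq: "q a = q b"
    then obtain h v h' v' where hv: "a = \<Theta> (h, v)" "h \<in> U" "v \<in> ball w (\<epsilon> / 2)"
        "b = \<Theta> (h', v')" "h' \<in> U" "v' \<in> ball w (\<epsilon> / 2)"
      by (auto simp: N_def)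
    have G: "h \<in> carrier G" "h' \<in> carrier G"
      using hv U' by auto
    then obtain \<gamma> m where \<gamma>: "\<gamma> \<in> \<Gamma>" "m \<in> M" "h' = \<gamma> \<otimes> h" "v' = m + \<sigma> \<gamma> v"
      using eq hv q_eq_iff by auto
    then have h: "h = h'"
      using U'(3) hv G by (metis inj_onD pr_mult_\<Gamma>)
    then have "\<gamma> = \<one>"
      using \<gamma> G by (metis \<Gamma>_closed r_cancel_one')
    then have v: "v' = m + v"
      using \<gamma> by (simp add: rep_one)
    have "dist v v' < \<epsilon>"
      using hv dist_triangle_half_r[of w v \<epsilon> v'] by simp
    then have "norm m < \<epsilon>"
      by (simp add: v dist_norm)
    then have "m = 0"
      using M_discrete \<gamma> by simp
    then show "a = b"
      using hv h v by simp
  qed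
  have "\<kappa> ` N = D ` U \<times> ball w (\<epsilon> / 2)"
    unfolding N_def image_image using \<kappa>(2) by (force simp: image_iff)
  then have "open (\<kappa> ` N)"
    using U' by (simp add: open_Times)
  moreover have "N \<subseteq> \<Theta> ` (U \<times> UNIV)"
    unfolding N_def by (intro image_mono Sigma_mono) auto
  ultimately have "(q ` N, \<kappa> \<circ> inv_into N q) \<in> quotient_atlas EA q"
    unfolding quotient_atlas_def using \<kappa>(1) inj
    by (intro CollectI exI[of _ N] exI[of _ "\<Theta> ` (U \<times> UNIV)"] exI[of _ \<kappa>]) simp
  moreover have "(\<kappa> \<circ> inv_into N q) (\<Psi> (h, v)) = (D h, v)" if "h \<in> U" "v \<in> ball w (\<epsilon> / 2)" for h v
  proof -
    have "\<Theta> (h, v) \<in> N"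
      using that by (auto simp: N_def)
    then show ?thesis
      using inj that \<kappa>(2) by (simp add: inv_into_f_f)
  qed
  ultimately show thesis
    by (intro that[of "\<kappa> \<circ> inv_into N q"]) (simp_all add: N_def image_image)
qed

text \<open>With \<open>z = ((\<phi> g, y), (D h, v))\<close>, the value \<open>P z\<close> is
  \<open>D (h \<otimes> inv g)\<close> and the pair gives the coordinates of the image of
  \<open>(h, v)\<close> under \<open>(g, y)\<close>. The chart \<open>\<phi>\<close> is first
  exchanged for \<open>D\<close>; the term with \<open>R\<close> is smooth because operator
  application is bilinear.\<close>

lemma smooth_on_action_coordinates:
  assumes c: "(U, \<phi>) \<in> A" and Q: "open Q" "\<And>z. z \<in> Q \<Longrightarrow> fst (fst z) \<in> \<phi> ` U"
    and P_def: "\<And>z. P z = D (Dinv (fst (snd z)) \<otimes> inv (inv_into U \<phi> (fst (fst z))))"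
  shows "smooth_on Q (\<lambda>z. (P z, snd (snd z) - R (P z) (snd (fst z))))"
proof -
  note bl = bounded_linear_compose[OF bounded_linear_fst bounded_linear_fst]
    bounded_linear_compose[OF bounded_linear_fst bounded_linear_snd]
    bounded_linear_compose[OF bounded_linear_snd bounded_linear_fst]
    bounded_linear_compose[OF bounded_linear_snd bounded_linear_snd]
  have U: "U \<subseteq> carrier G"
    using pointsI[OF c] atlas(2) by auto
  have inv_U: "inv_into U \<phi> (fst (fst z)) \<in> carrier G" if "z \<in> Q" for z
    by (rule subsetD[OF U inv_into_into[OF Q(2)[OF that]]])
  have 1: "smooth_on Q (\<lambda>z. (D \<circ> inv_into U \<phi>) (fst (fst z)))"
    by (rule smooth_on_comp_linear[OF bl(1) Q(1) smooth_map_imp_smooth_on_chart[OF atlas(1) c smooth_D]])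
      (use Q(2) in \<open>simp add: image_subset_iff\<close>)
  have 2: "smooth_on Q (\<lambda>z. D (inv Dinv ((D \<circ> inv_into U \<phi>) (fst (fst z)))))"
    by (rule smooth_on_compose[OF Q(1) 1 smooth_on_inv]) simp
  have 3: "smooth_on Q (\<lambda>z. (\<lambda>z. D (Dinv (fst z) \<otimes> Dinv (snd z)))
      (fst (snd z), D (inv Dinv ((D \<circ> inv_into U \<phi>) (fst (fst z))))))"
    by (rule smooth_on_compose[OF Q(1) smooth_on_Pair[OF Q(1) smooth_on_bounded_linear[OF bl(2)] 2]
          smooth_on_mult]) simp
  have P: "smooth_on Q P"
    by (rule smooth_on_cong[OF 3 Q(1)]) (simp add: inv_U P_def)
  have "smooth_on Q (\<lambda>z. R (P z) (snd (fst z)))"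
    by (rule smooth_on_bilinear[OF bounded_bilinear_blinfun_apply Q(1)
          smooth_on_compose[OF Q(1) P smooth_R] smooth_on_bounded_linear[OF bl(3)]]) simp
  then show ?thesis
    by (rule smooth_on_Pair[OF Q(1) P smooth_on_diff[OF Q(1) smooth_on_bounded_linear[OF bl(4)]]])
qed

theorem smooth_transitive_action_torus:
  "\<exists>\<Phi>. smooth_transitive_action (semidirect G \<sigma> UNIV) (product_atlas A vector_space_atlas)
        (\<Psi> ` (carrier G \<times> UNIV)) (quotient_atlas EA q) \<Phi> \<and>
      stabilizer (semidirect G \<sigma> UNIV) \<Phi> (\<Psi> (\<one>, 0))
        = carrier (semidirect (G\<lparr>carrier := \<Gamma>\<rparr>) \<sigma> M)"
proof -
  let ?H = "semidirect G \<sigma> UNIV" and ?AH = "product_atlas A (vector_space_atlas :: ('v, 'v) atlas)"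
  have pair: "\<Psi> (h, v) = \<Psi> (h', v') \<longleftrightarrow> (\<exists>k\<in>\<Gamma> \<times> M. (h', v') = k \<otimes>\<^bsub>?H\<^esub> (h, v))"
    if "h \<in> carrier G" "h' \<in> carrier G" for h v h' v'
    unfolding q_eq_iff[OF that] split_paired_Bex_Sigma semidirect_simps prod.inject by (rule refl)
  have cosets: "\<Psi> a = \<Psi> b \<longleftrightarrow> (\<exists>k\<in>\<Gamma> \<times> M. b = k \<otimes>\<^bsub>?H\<^esub> a)"
    if "a \<in> carrier ?H" "b \<in> carrier ?H" for a b
    using pair[of "fst a" "fst b" "snd a" "snd b"] that
    by (simp only: prod.collapse semidirect_simps mem_Times_iff)
  obtain \<Phi> where trans: "transitive_action ?H (\<Psi> ` carrier ?H) \<Phi>"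
    and \<Phi>: "\<forall>h\<in>carrier ?H. \<forall>a\<in>carrier ?H. \<Phi> h (\<Psi> a) = \<Psi> (a \<otimes>\<^bsub>?H\<^esub> inv\<^bsub>?H\<^esub> h)"
    and stab: "stabilizer ?H \<Phi> (\<Psi> \<one>\<^bsub>?H\<^esub>) = \<Gamma> \<times> M"
    by (rule coset_action_exists[OF group_semidirect
        subgroup_semidirect[OF subgroup_\<Gamma> M_zero M_add M_minus M_invariant] refl cosets])
  \<comment> \<open>The inverse of \<open>(g, y)\<close> is
    \<open>(inv g, - \<sigma> (inv g) y)\<close>; multiplying by \<open>(h, v)\<close> on the left
    applies \<open>\<sigma> h\<close> to its second entry, and the two factors merge into
    \<open>\<sigma> (h \<otimes> inv g)\<close>.\<close>
  have \<Phi>_eq: "\<Phi> (g, y) (\<Psi> (h, v)) = \<Psi> (h \<otimes> inv g, v - \<sigma> (h \<otimes> inv g) y)"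
    if "g \<in> carrier G" "h \<in> carrier G" for g h y v
    using that by (simp add: \<Phi> inv_semidirect rep_minus rep_mult)
  have "smooth_map (product_atlas ?AH (quotient_atlas EA q))
      (quotient_atlas EA q) (\<lambda>(h, x). \<Phi> h x)"
  proof (rule smooth_mapI)
    fix p assume "p \<in> points (product_atlas ?AH (quotient_atlas EA q))"
    then obtain g0 y0 x0 where p: "p = ((g0, y0), x0)" "g0 \<in> carrier G" "x0 \<in> points (quotient_atlas EA q)"
      by (cases p) (auto simp: atlas)
    obtain U0 W0 \<kappa> where "x0 \<in> q ` U0" "(W0, \<kappa>) \<in> EA" "U0 \<subseteq> W0"
      using p(3) by (auto simp: points_def quotient_atlas_def)
    then have "x0 \<in> q ` \<Theta> ` (carrier G \<times> UNIV)"
      using chart_domains by blast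
    then obtain h0 v0 where x0: "h0 \<in> carrier G" "x0 = \<Psi> (h0, v0)"
      by auto
    \<comment> \<open>\<open>(k0, w0)\<close> represents the image of \<open>(h0, v0)\<close> under
      \<open>(g0, y0)\<close>; charts are chosen around both points.\<close>
    define k0 where "k0 = h0 \<otimes> inv g0"
    define w0 where "w0 = v0 - \<sigma> k0 y0"
    obtain U1 \<phi> where c: "(U1, \<phi>) \<in> A" "g0 \<in> U1"
      using p(2) atlas(2) by (metis pointsE)
    obtain U where U: "good U" "h0 \<in> U"
      using good_exists[OF x0(1)] .
    have "k0 \<in> carrier G"
      using x0 p by (simp add: k0_def)
    then obtain V where V: "good V" "k0 \<in> V"
      by (rule good_exists)
    define B where "B = ball v0 (\<epsilon> / 2)"
    define C where "C = ball w0 (\<epsilon> / 2)"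
    obtain \<xi> where \<xi>: "(\<Psi> ` (U \<times> B), \<xi>) \<in> quotient_atlas EA q"
      "\<And>h v. h \<in> U \<Longrightarrow> v \<in> B \<Longrightarrow> \<xi> (\<Psi> (h, v)) = (D h, v)"
      using torus_chart_exists[OF U(1)] unfolding B_def by blast
    obtain \<zeta> where \<zeta>: "(\<Psi> ` (V \<times> C), \<zeta>) \<in> quotient_atlas EA q"
      "\<And>h v. h \<in> V \<Longrightarrow> v \<in> C \<Longrightarrow> \<zeta> (\<Psi> (h, v)) = (D h, v)"
      using torus_chart_exists[OF V(1)] unfolding C_def by blast
    have U': "U \<subseteq> carrier G" "open (D ` U)" and V': "V \<subseteq> carrier G" "open (D ` V)"
      using U V by (auto simp: good_def)
    have U1: "U1 \<subseteq> carrier G" "inj_on \<phi> U1" "open (\<phi> ` U1)"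
      using pointsI[OF c(1)] atlas(2) smooth_atlasD(1,2)[OF atlas(1) c(1)] by auto
    let ?dom = "(U1 \<times> UNIV) \<times> \<Psi> ` (U \<times> B)"
    let ?chart = "map_prod (map_prod \<phi> id) \<xi>"
    have chart: "(?dom, ?chart) \<in> product_atlas ?AH (quotient_atlas EA q)"
      using c(1) \<xi>(1) by (intro product_atlasI) (auto simp: vector_space_atlas_def)
    define Q where "Q = (\<phi> ` U1 \<times> (UNIV :: 'v set)) \<times> D ` U \<times> B"
    \<comment> \<open>\<open>J\<close> is an explicit inverse of the product chart. It removes
      \<open>inv_into\<close> of that chart from the local representative of the action, which
      becomes \<open>F\<close>.\<close>
    define J where "J z = ((inv_into U1 \<phi> (fst (fst z)), snd (fst z)),
        \<Psi> (Dinv (fst (snd z)), snd (snd z)))" for z :: "((real ^ 'n) \<times> 'v) \<times> (real ^ 'n) \<times> 'v"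
    define P where "P z = D (Dinv (fst (snd z)) \<otimes> inv (inv_into U1 \<phi> (fst (fst z))))"
      for z :: "((real ^ 'n) \<times> 'v) \<times> (real ^ 'n) \<times> 'v"
    define F where "F z = (P z, snd (snd z) - R (P z) (snd (fst z)))"
      for z :: "((real ^ 'n) \<times> 'v) \<times> (real ^ 'n) \<times> 'v"
    have openQ: "open Q"
      using U' U1 by (auto simp: Q_def B_def intro!: open_Times)
    have F_smooth: "smooth_on Q F"
      unfolding F_def[abs_def]
      by (rule smooth_on_action_coordinates[OF c(1) openQ]) (auto simp: Q_def P_def)
    have J: "?chart (J z) = z" "J z \<in> ?dom" if "z \<in> Q" for z
      using that \<xi>(2) U' U1 by (auto simp: Q_def J_def)
    have J_inv: "J (?chart x) = x" if "x \<in> ?dom" for x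
      using that \<xi>(2) U' U1 by (auto simp: J_def subset_iff)
    have inv_J: "inv_into ?dom ?chart z = J z" if "z \<in> Q" for z
      by (rule inv_into_f_eq[OF inj_on_inverseI[of _ J]]) (use J J_inv that in auto)
    have \<Phi>_J: "(\<lambda>(h, x). \<Phi> h x) (J z) = \<Psi> (Dinv (fst (F z)), snd (F z))" if "z \<in> Q" for z
    proof -
      have "inv_into U1 \<phi> (fst (fst z)) \<in> carrier G"
        using that U1 by (auto simp: Q_def)
      then show ?thesis
        by (simp add: J_def F_def P_def R \<Phi>_eq)
    qed
    \<comment> \<open>\<open>F\<close> need not map all of \<open>Q\<close> into the target chart;
      this preimage is open by continuity and contains the coordinates of \<open>p\<close>.\<close>
    define Q' where "Q' = Q \<inter> F -` (D ` V \<times> C)"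
    have openQ': "open Q'"
      unfolding Q'_def using V'
      by (intro continuous_open_preimage smooth_on_imp_continuous_on[OF F_smooth] openQ open_Times)
        (auto simp: C_def)
    have \<zeta>F: "\<Psi> (Dinv (fst (F z)), snd (F z)) \<in> \<Psi> ` (V \<times> C)"
      "\<zeta> (\<Psi> (Dinv (fst (F z)), snd (F z))) = F z" if "z \<in> Q'" for z
    proof -
      have *: "Dinv (fst (F z)) \<in> V" "snd (F z) \<in> C"
        using that V' by (auto simp: Q'_def)
      then show "\<Psi> (Dinv (fst (F z)), snd (F z)) \<in> \<Psi> ` (V \<times> C)"
        by blast
      show "\<zeta> (\<Psi> (Dinv (fst (F z)), snd (F z))) = F z"
        using \<zeta>(2)[OF *] by simp
    qed
    have QQ: "Q' \<subseteq> Q" by (auto simp: Q'_def)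
    have image: "?chart ` (J ` Q') = Q'"
      using image_cong[OF refl J(1)[OF subsetD[OF QQ]], of Q'] by (simp only: image_image image_ident)
    define z0 where "z0 = ((\<phi> g0, y0), (D h0, v0))"
    have z0: "z0 \<in> Q" "J z0 = p" "F z0 = (D k0, w0)"
      using c U x0 p U1 \<epsilon>_pos
      by (auto simp: z0_def Q_def B_def J_def F_def P_def k0_def w0_def R)
    have "z0 \<in> Q'"
      using z0 V(2) \<epsilon>_pos by (auto simp: Q'_def C_def)
    then have "p \<in> J ` Q'"
      using z0(2) by blast
    moreover have "J ` Q' \<subseteq> ?dom"
      using J(2) QQ by blast
    moreover have "(\<lambda>(h, x). \<Phi> h x) ` J ` Q' \<subseteq> \<Psi> ` (V \<times> C)"
      unfolding image_image image_subset_iff using \<Phi>_J \<zeta>F(1) QQ by (metis subsetD)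
    moreover have "smooth_on Q' (\<zeta> \<circ> (\<lambda>(h, x). \<Phi> h x) \<circ> inv_into ?dom ?chart)"
    proof (rule smooth_on_cong[OF smooth_on_subset[OF F_smooth QQ] openQ'])
      fix z assume z: "z \<in> Q'"
      then have "z \<in> Q" using QQ by blast
      then show "F z = (\<zeta> \<circ> (\<lambda>(h, x). \<Phi> h x) \<circ> inv_into ?dom ?chart) z"
        using \<zeta>F(2)[OF z] \<Phi>_J inv_J by (simp del: split_paired_All)
    qed
    ultimately show "\<exists>U \<phi> V \<psi> W. (U, \<phi>) \<in> product_atlas ?AH (quotient_atlas EA q)
        \<and> (V, \<psi>) \<in> quotient_atlas EA q \<and> p \<in> W \<and> W \<subseteq> U \<and> open (\<phi> ` W) \<and>
        (\<lambda>(h, x). \<Phi> h x) ` W \<subseteq> V \<and> smooth_on (\<phi> ` W) (\<psi> \<circ> (\<lambda>(h, x). \<Phi> h x) \<circ> inv_into U \<phi>)"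
      using chart \<zeta>(1) openQ'
      by (intro exI[of _ ?dom] exI[of _ ?chart] exI[of _ "\<Psi> ` (V \<times> C)"] exI[of _ \<zeta>] exI[of _ "J ` Q'"])
        (simp only: image simp_thms)
  qed
  then show ?thesis
    using trans stab unfolding smooth_transitive_action_def
    by (intro exI[of _ \<Phi>]) simp
qed

end

section \<open>Fibrewise quotients and tangent vectors of the base\<close>

text \<open>Zero, negatives and sums in \<open>L p\<close> give reflexivity, symmetry and
  transitivity.\<close>

lemma equiv_fibre_rel:
  assumes "\<And>p \<xi>. (p, \<xi>) \<in> E \<Longrightarrow> (\<lambda>_. 0) \<in> L p"
    and "\<And>p \<xi> \<eta> x. (p, x) \<in> E \<Longrightarrow> \<xi> \<in> L p \<Longrightarrow> \<eta> \<in> L p \<Longrightarrow> (\<lambda>c. \<xi> c + \<eta> c) \<in> L p"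
    and "\<And>p \<xi> x. (p, x) \<in> E \<Longrightarrow> \<xi> \<in> L p \<Longrightarrow> (\<lambda>c. - \<xi> c) \<in> L p"
  shows "equiv E (fibre_rel E L)"
proof (rule equivI)
  show "fibre_rel E L \<subseteq> E \<times> E"
    by (auto simp: fibre_rel_def)
  show "refl_on E (fibre_rel E L)"
    using assms(1) by (auto simp: fibre_rel_def refl_on_def)
  show "sym (fibre_rel E L)"
  proof (rule symI)
    fix x y assume "(x, y) \<in> fibre_rel E L"
    then obtain p \<xi> \<eta> where *: "x = (p, \<xi>)" "y = (p, \<eta>)" "(p, \<xi>) \<in> E" "(p, \<eta>) \<in> E"
        "(\<lambda>c. \<eta> c - \<xi> c) \<in> L p"
      by (auto simp: fibre_rel_def)
    then have "(\<lambda>c. \<xi> c - \<eta> c) \<in> L p"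
      using assms(3)[OF *(3,5)] by simp
    then show "(y, x) \<in> fibre_rel E L"
      using * by (simp add: fibre_rel_def)
  qed
  show "trans (fibre_rel E L)"
  proof (rule transI)
    fix x y z assume "(x, y) \<in> fibre_rel E L" "(y, z) \<in> fibre_rel E L"
    then obtain p \<xi> \<eta> \<zeta> where *: "x = (p, \<xi>)" "y = (p, \<eta>)" "z = (p, \<zeta>)" "(p, \<xi>) \<in> E" "(p, \<zeta>) \<in> E"
        "(\<lambda>c. \<eta> c - \<xi> c) \<in> L p" "(\<lambda>c. \<zeta> c - \<eta> c) \<in> L p"
      by (auto simp: fibre_rel_def)
    then have "(\<lambda>c. \<zeta> c - \<xi> c) \<in> L p"
      using assms(2)[OF *(4,6,7)] by simp
    then show "(x, z) \<in> fibre_rel E L"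
      using * by (simp add: fibre_rel_def)
  qed
qed

context integral_affine_quotient
begin

text \<open>A bundle \<open>E\<close> over \<open>pr ` G\<close> that is trivialized by an equivariant frame \<open>\<tau>\<close> over \<open>G\<close>.\<close>

lemma fibre_proj_frame_eq_iff:
  fixes \<tau> :: "'g \<Rightarrow> 'v::ab_group_add \<Rightarrow> 'x \<Rightarrow> 'w::ab_group_add"
  assumes E: "E = (\<lambda>(h, v). (pr h, \<tau> h v)) ` (carrier G \<times> UNIV)"
    and \<tau>_add: "\<And>h v w c. h \<in> carrier G \<Longrightarrow> \<tau> h (v + w) c = \<tau> h v c + \<tau> h w c"
    and \<tau>_inj: "\<And>h. h \<in> carrier G \<Longrightarrow> inj (\<tau> h)"
    and \<tau>_\<Gamma>: "\<And>\<gamma> h v. \<gamma> \<in> \<Gamma> \<Longrightarrow> h \<in> carrier G \<Longrightarrow> \<tau> (\<gamma> \<otimes> h) (\<sigma> \<gamma> v) = \<tau> h v"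
    and L: "\<And>h. h \<in> carrier G \<Longrightarrow> L (pr h) = \<tau> h ` M"
    and M: "0 \<in> M" "\<And>x y. x \<in> M \<Longrightarrow> y \<in> M \<Longrightarrow> x + y \<in> M" "\<And>x. x \<in> M \<Longrightarrow> - x \<in> M"
    and h: "h \<in> carrier G" "h' \<in> carrier G"
  shows "fibre_proj E L (pr h, \<tau> h v) = fibre_proj E L (pr h', \<tau> h' v') \<longleftrightarrow>
    (\<exists>\<gamma>\<in>\<Gamma>. \<exists>m\<in>M. h' = \<gamma> \<otimes> h \<and> v' = m + \<sigma> \<gamma> v)"
proof -
  have \<tau>_zero: "\<tau> h 0 c = 0" if "h \<in> carrier G" for h c
    using \<tau>_add[OF that, of 0 0 c] by simp
  have \<tau>_minus: "\<tau> h (- v) c = - \<tau> h v c" if "h \<in> carrier G" for h v c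
    using \<tau>_add[OF that, of v "- v" c] \<tau>_zero[OF that, of c] by (simp add: eq_neg_iff_add_eq_0 add.commute)
  have \<tau>_diff: "(\<lambda>c. \<tau> h v c - \<tau> h w c) = \<tau> h (v - w)" if "h \<in> carrier G" for h v w
    using \<tau>_add[OF that, of v "- w"] \<tau>_minus[OF that] by auto
  have mem: "(pr h, \<tau> h v) \<in> E" if "h \<in> carrier G" for h v
    unfolding E using that by (intro image_eqI[of _ _ "(h, v)"]) auto
  have baseE: thesis if "(p, x) \<in> E" "\<And>h. h \<in> carrier G \<Longrightarrow> p = pr h \<Longrightarrow> thesis" for p x thesis
    using that unfolding E by auto
  have "equiv E (fibre_rel E L)"
  proof (rule equiv_fibre_rel)
    fix p x assume px: "(p, x) \<in> E"
    then obtain h where h: "h \<in> carrier G" "p = pr h"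
      by (rule baseE)
    have "\<tau> h 0 = (\<lambda>_. 0)"
      using \<tau>_zero[OF h(1)] by auto
    then show "(\<lambda>_. 0) \<in> L p"
      unfolding h(2) L[OF h(1)] using M(1) by (metis imageI)
    show "(\<lambda>c. - \<xi> c) \<in> L p" if xi: "\<xi> \<in> L p" for \<xi>
    proof -
      obtain m where m: "m \<in> M" "\<xi> = \<tau> h m"
        using xi L[OF h(1)] h(2) by auto
      then have "(\<lambda>c. - \<xi> c) = \<tau> h (- m)"
        using \<tau>_minus[OF h(1)] by auto
      then show ?thesis
        using m(1) M(3) L[OF h(1)] h(2) by simp
    qed
    show "(\<lambda>c. \<xi> c + \<eta> c) \<in> L p" if xi: "\<xi> \<in> L p" "\<eta> \<in> L p" for \<xi> \<eta>
    proof -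
      obtain m m' where m: "m \<in> M" "\<xi> = \<tau> h m" "m' \<in> M" "\<eta> = \<tau> h m'"
        using xi L[OF h(1)] h(2) by auto
      then have "(\<lambda>c. \<xi> c + \<eta> c) = \<tau> h (m + m')"
        using \<tau>_add[OF h(1)] by auto
      then show ?thesis
        using m M(2) L[OF h(1)] h(2) by simp
    qed
  qed
  then have "fibre_proj E L (pr h, \<tau> h v) = fibre_proj E L (pr h', \<tau> h' v') \<longleftrightarrow>
      ((pr h, \<tau> h v), (pr h', \<tau> h' v')) \<in> fibre_rel E L"
    unfolding fibre_proj_def using mem h by (intro eq_equiv_class_iff)
  also have "\<dots> \<longleftrightarrow> pr h = pr h' \<and> (\<lambda>c. \<tau> h' v' c - \<tau> h v c) \<in> \<tau> h' ` M"
    using mem h L[OF h(2)] by (auto simp: fibre_rel_def)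
  also have "\<dots> \<longleftrightarrow> (\<exists>\<gamma>\<in>\<Gamma>. h' = \<gamma> \<otimes> h \<and> (\<lambda>c. \<tau> h' v' c - \<tau> h v c) \<in> \<tau> h' ` M)"
    unfolding pr_eq_iff[OF h] by blast
  also have "\<dots> \<longleftrightarrow> (\<exists>\<gamma>\<in>\<Gamma>. h' = \<gamma> \<otimes> h \<and> v' - \<sigma> \<gamma> v \<in> M)"
  proof (intro bex_cong refl conj_cong)
    fix \<gamma> assume \<gamma>: "\<gamma> \<in> \<Gamma>" "h' = \<gamma> \<otimes> h"
    \<comment> \<open>Rewriting the vector over \<open>h\<close> in the frame over \<open>h'\<close>
      allows the two to be subtracted inside one frame; injectivity of \<open>\<tau> h'\<close> then
      turns membership in the fibrewise lattice into membership in \<open>M\<close>.\<close>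
    have "\<tau> h' (\<sigma> \<gamma> v) = \<tau> h v"
      unfolding \<gamma>(2) by (rule \<tau>_\<Gamma>[OF \<gamma>(1) h(1)])
    then have "(\<lambda>c. \<tau> h' v' c - \<tau> h v c) = \<tau> h' (v' - \<sigma> \<gamma> v)"
      unfolding \<tau>_diff[OF h(2), symmetric] by simp
    then show "(\<lambda>c. \<tau> h' v' c - \<tau> h v c) \<in> \<tau> h' ` M \<longleftrightarrow> v' - \<sigma> \<gamma> v \<in> M"
      using \<tau>_inj[OF h(2)] by (simp add: inj_image_mem_iff)
  qed
  also have "\<dots> \<longleftrightarrow> (\<exists>\<gamma>\<in>\<Gamma>. \<exists>m\<in>M. h' = \<gamma> \<otimes> h \<and> v' = m + \<sigma> \<gamma> v)"
  proof -
    have "x - y \<in> M \<longleftrightarrow> (\<exists>m\<in>M. x = m + y)" for x y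
      by (metis add_diff_cancel diff_add_cancel)
    then show ?thesis
      by simp
  qed
  finally show ?thesis .
qed

section \<open>Local affine coordinates of the base and their transition functions\<close>

abbreviation base :: "('g set, real ^ 'n) atlas" where
  "base \<equiv> base_atlas G \<Gamma> D"

abbreviation coord :: "'g set \<Rightarrow> 'g set \<Rightarrow> real ^ 'n" where
  "coord U \<equiv> D \<circ> inv_into U pr"

lemma base_iff: "(W, \<phi>) \<in> base \<longleftrightarrow> (\<exists>U. good U \<and> W = pr ` U \<and> \<phi> = coord U)"
  unfolding base_atlas_def quotient_atlas_def good_def by blast

lemma baseI: "good U \<Longrightarrow> (pr ` U, coord U) \<in> base"
  using base_iff by blast

lemma good_carrier: "good U \<Longrightarrow> h \<in> U \<Longrightarrow> h \<in> carrier G"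
  by (auto simp: good_def)

text \<open>The chart sees the coset through its unique representative in \<open>U\<close>, here
  \<open>\<gamma> \<otimes> h\<close>.\<close>

lemma coord_pr:
  assumes "good U" "h \<in> carrier G" "\<gamma> \<in> \<Gamma>" "\<gamma> \<otimes> h \<in> U"
  shows "coord U (pr h) = D (\<gamma> \<otimes> h)"
proof -
  have "inv_into U pr (pr (\<gamma> \<otimes> h)) = \<gamma> \<otimes> h"
    using assms by (simp add: good_def inv_into_f_f del: pr_mult_\<Gamma>)
  then show ?thesis
    using assms by simp
qed

lemma coord_pr_self: "good U \<Longrightarrow> h \<in> U \<Longrightarrow> coord U (pr h) = D h"
  using coord_pr[of U h \<one>] subgroup.one_closed[OF subgroup_\<Gamma>] good_carrier by simp

lemma inv_into_coord:
  assumes "good U" "h \<in> U"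
  shows "inv_into (pr ` U) (coord U) (D h) = pr h"
proof (rule inv_into_f_eq)
  show "inj_on (coord U) (pr ` U)"
  proof (rule inj_onI)
    fix p q assume "p \<in> pr ` U" "q \<in> pr ` U" "coord U p = coord U q"
    then obtain a b where ab: "a \<in> U" "b \<in> U" "p = pr a" "q = pr b" "D a = D b"
      using coord_pr_self[OF assms(1)] by auto
    then have "a = b"
      using inj_D good_carrier[OF assms(1)] by (simp add: inj_on_def)
    then show "p = q"
      using ab by simp
  qed
qed (use assms coord_pr_self in auto)

lemma inv_into_coord':
  assumes "good U" "x \<in> D ` U"
  shows "inv_into (pr ` U) (coord U) x = pr (Dinv x)"
proof -
  obtain h where "h \<in> U" "x = D h"
    using assms(2) by auto
  then show ?thesis
    using inv_into_coord good_carrier assms(1) by simp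
qed

text \<open>As \<open>D\<close> maps \<open>U\<close> onto an open set, the same \<gamma> still
  selects the representative in \<open>U\<close> for all points near \<open>D h\<close>. There the
  coordinate is the affine map \<open>x \<mapsto> D \<gamma> + \<rho> \<gamma> x\<close>.\<close>

lemma has_derivative_coord:
  assumes U: "good U" and h: "h \<in> carrier G" and \<gamma>: "\<gamma> \<in> \<Gamma>" "\<gamma> \<otimes> h \<in> U"
  shows "((coord U \<circ> (\<lambda>x. pr (Dinv x))) has_derivative \<rho> \<gamma>) (at (D h))"
proof -
  have eq: "D (\<gamma> \<otimes> Dinv x) = D \<gamma> + \<rho> \<gamma> x" for x
    using \<gamma>(1) by (simp add: D_mult)
  have bl: "bounded_linear (\<rho> \<gamma>)"
    using \<gamma>(1) by (simp add: bounded_linear_\<rho>)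
  have "((\<lambda>x. D \<gamma> + \<rho> \<gamma> x) has_derivative \<rho> \<gamma>) (at (D h))"
    using has_derivative_add[OF has_derivative_const[of "D \<gamma>"] bounded_linear_imp_has_derivative[OF bl]]
    by simp
  moreover have "open ((\<lambda>x. D \<gamma> + \<rho> \<gamma> x) -` (D ` U))"
    using U bl by (intro open_vimage continuous_intros linear_continuous_on) (simp add: good_def)
  moreover have "D h \<in> (\<lambda>x. D \<gamma> + \<rho> \<gamma> x) -` (D ` U)"
    using h \<gamma> by (simp add: eq[symmetric])
  moreover have "D \<gamma> + \<rho> \<gamma> x = (coord U \<circ> (\<lambda>x. pr (Dinv x))) x"
    if x: "x \<in> (\<lambda>x. D \<gamma> + \<rho> \<gamma> x) -` (D ` U)" for x
  proof -
    obtain k where k: "k \<in> U" "D (\<gamma> \<otimes> Dinv x) = D k"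
      using x by (auto simp: eq)
    then have "\<gamma> \<otimes> Dinv x = k"
      using inj_D good_carrier[OF U] \<gamma>(1) by (auto simp: inj_on_def)
    then show ?thesis
      using coord_pr[OF U Dinv_closed \<gamma>(1), of x] k(1) by (simp add: eq[symmetric])
  qed
  ultimately show ?thesis
    by (rule has_derivative_transform_within_open)
qed

lemma has_derivative_transition:
  assumes U: "good U" "h \<in> U" and V: "good V" "\<gamma> \<in> \<Gamma>" "\<gamma> \<otimes> h \<in> V"
  shows "((coord V \<circ> inv_into (pr ` U) (coord U)) has_derivative \<rho> \<gamma>) (at (D h))"
proof (rule has_derivative_transform_within_open)
  show "((coord V \<circ> (\<lambda>x. pr (Dinv x))) has_derivative \<rho> \<gamma>) (at (D h))"
    using has_derivative_coord good_carrier assms by blast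
  show "open (D ` U)" "D h \<in> D ` U"
    using U by (auto simp: good_def)
qed (simp add: inv_into_coord'[OF U(1)])

text \<open>Used to compare two charts at one coset: if they select the representatives \<gamma>h
  and \<delta>h, this quotient carries the first to the second and so determines the derivative of
  the transition.\<close>

lemma \<Gamma>_quotient:
  assumes "\<delta> \<in> \<Gamma>" "\<gamma> \<in> \<Gamma>" "h \<in> carrier G"
  shows "\<delta> \<otimes> inv \<gamma> \<in> \<Gamma>" "(\<delta> \<otimes> inv \<gamma>) \<otimes> (\<gamma> \<otimes> h) = \<delta> \<otimes> h"
proof -
  show "\<delta> \<otimes> inv \<gamma> \<in> \<Gamma>"
    using assms subgroup.m_closed[OF subgroup_\<Gamma>] subgroup.m_inv_closed[OF subgroup_\<Gamma>] by blast
  have "(\<delta> \<otimes> inv \<gamma>) \<otimes> (\<gamma> \<otimes> h) = \<delta> \<otimes> (inv \<gamma> \<otimes> (\<gamma> \<otimes> h))"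
    using assms by (simp add: m_assoc)
  also have "\<dots> = \<delta> \<otimes> h"
    using assms by (simp add: m_assoc[symmetric])
  finally show "(\<delta> \<otimes> inv \<gamma>) \<otimes> (\<gamma> \<otimes> h) = \<delta> \<otimes> h" .
qed

text \<open>Each chart at a coset is recorded with the \<gamma> that moves \<open>h\<close> into its
  domain; all derivatives below are expressed through this \<gamma>.\<close>

lemma charts_at_base:
  assumes "h \<in> carrier G"
  shows "c \<in> charts_at base (pr h) \<longleftrightarrow>
    (\<exists>U. \<exists>\<gamma>\<in>\<Gamma>. good U \<and> \<gamma> \<otimes> h \<in> U \<and> c = (pr ` U, coord U))"
proof
  assume "c \<in> charts_at base (pr h)"
  then obtain U where U: "good U" "c = (pr ` U, coord U)" "pr h \<in> pr ` U"
    by (cases c) (auto simp: charts_at_def base_iff)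
  then obtain k where k: "k \<in> U" "pr h = pr k"
    by auto
  then show "\<exists>U. \<exists>\<gamma>\<in>\<Gamma>. good U \<and> \<gamma> \<otimes> h \<in> U \<and> c = (pr ` U, coord U)"
    using U pr_eq_iff[OF assms good_carrier[OF U(1) k(1)]] by blast
next
  assume "\<exists>U. \<exists>\<gamma>\<in>\<Gamma>. good U \<and> \<gamma> \<otimes> h \<in> U \<and> c = (pr ` U, coord U)"
  then obtain U \<gamma> where U: "\<gamma> \<in> \<Gamma>" "good U" "\<gamma> \<otimes> h \<in> U" "c = (pr ` U, coord U)"
    by blast
  then have "pr h \<in> pr ` U"
    using assms by (metis imageI pr_mult_\<Gamma>)
  then show "c \<in> charts_at base (pr h)"
    using U baseI by (simp add: charts_at_def)
qed

lemma points_base: "points base = pr ` carrier G"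
proof (intro equalityI subsetI)
  fix p assume "p \<in> points base"
  then obtain W \<phi> where "(W, \<phi>) \<in> base" "p \<in> W"
    by (rule pointsE)
  then obtain U where "good U" "p \<in> pr ` U"
    unfolding base_iff by blast
  then show "p \<in> pr ` carrier G"
    by (auto simp: good_carrier)
next
  fix p assume "p \<in> pr ` carrier G"
  then obtain h where h: "h \<in> carrier G" "p = pr h"
    by auto
  obtain U where "good U" "h \<in> U"
    using good_exists[OF h(1)] .
  then show "p \<in> points base"
    using h(2) by (intro pointsI[OF baseI]) auto
qed

text \<open>The push-forward of \<open>v\<close> along the covering of \<open>B\<close>, read in the
  coordinate \<open>D\<close>. It depends on the representative \<open>h\<close>, so it is a frame
  of the bundle pulled back to \<open>G\<close>, not of the bundle over \<open>B\<close>.\<close>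

definition tvec :: "'g \<Rightarrow> real ^ 'n \<Rightarrow> ('g set, real ^ 'n) chart \<Rightarrow> real ^ 'n" where
  "tvec h v = differential base (\<lambda>x. pr (Dinv x)) (D h) v"

lemma tvec_chart:
  assumes "good U" "h \<in> carrier G" "\<gamma> \<in> \<Gamma>" "\<gamma> \<otimes> h \<in> U"
  shows "tvec h v (pr ` U, coord U) = \<rho> \<gamma> v"
proof -
  have "(pr ` U, coord U) \<in> charts_at base (pr h)"
    using assms charts_at_base by blast
  then show ?thesis
    using assms frechet_derivative_eq[OF has_derivative_coord[OF assms]]
    by (simp add: tvec_def differential_def)
qed

lemma tvec_outside: "h \<in> carrier G \<Longrightarrow> c \<notin> charts_at base (pr h) \<Longrightarrow> tvec h v c = 0"
  by (simp add: tvec_def differential_def)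

lemma tvec_chart_self: "good U \<Longrightarrow> h \<in> U \<Longrightarrow> tvec h v (pr ` U, coord U) = v"
  using tvec_chart[of U h \<one>] subgroup.one_closed[OF subgroup_\<Gamma>] good_carrier by simp

lemma linear_tvec:
  assumes h: "h \<in> carrier G"
  shows "linear (\<lambda>v. tvec h v c)"
proof (cases "c \<in> charts_at base (pr h)")
  case True
  then obtain U \<gamma> where "\<gamma> \<in> \<Gamma>" "good U" "\<gamma> \<otimes> h \<in> U" "c = (pr ` U, coord U)"
    using charts_at_base[OF h] by blast
  then show ?thesis
    using linear_\<rho> h by (simp add: tvec_chart)
next
  case False
  then show ?thesis
    using h by (simp add: tvec_outside module_hom_zero)
qed

text \<open>In a chart that selects \<delta>h, the representative \<gamma>h is reached through
  \<delta>\<gamma>^-1, and applying \<rho> of this element to \<open>\<rho> \<gamma> v\<close>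
  leaves \<open>\<rho> \<delta> v\<close>, the coordinates of \<open>tvec h v\<close>.\<close>

lemma tvec_\<Gamma>:
  assumes \<gamma>: "\<gamma> \<in> \<Gamma>" and h: "h \<in> carrier G"
  shows "tvec (\<gamma> \<otimes> h) (\<rho> \<gamma> v) = tvec h v"
proof
  fix c
  show "tvec (\<gamma> \<otimes> h) (\<rho> \<gamma> v) c = tvec h v c"
  proof (cases "c \<in> charts_at base (pr h)")
    case True
    then obtain U \<delta> where U: "\<delta> \<in> \<Gamma>" "good U" "\<delta> \<otimes> h \<in> U" "c = (pr ` U, coord U)"
      using charts_at_base[OF h] by blast
    have *: "\<delta> \<otimes> inv \<gamma> \<in> \<Gamma>" "(\<delta> \<otimes> inv \<gamma>) \<otimes> (\<gamma> \<otimes> h) = \<delta> \<otimes> h"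
      by (rule \<Gamma>_quotient[OF U(1) \<gamma> h])+
    have "tvec (\<gamma> \<otimes> h) (\<rho> \<gamma> v) c = \<rho> (\<delta> \<otimes> inv \<gamma>) (\<rho> \<gamma> v)"
      unfolding U(4) by (rule tvec_chart) (use * U \<gamma> h in auto)
    also have "\<dots> = \<rho> \<delta> v"
      using U \<gamma> by (simp add: \<rho>_mult)
    also have "\<dots> = tvec h v c"
      unfolding U(4) by (rule tvec_chart[symmetric]) (use U h in auto)
    finally show ?thesis .
  next
    case False
    then show ?thesis
      using \<gamma> h by (simp add: tvec_outside)
  qed
qed

lemma inj_tvec:
  assumes h: "h \<in> carrier G"
  shows "inj (tvec h)"
proof (rule injI)
  fix v w assume "tvec h v = tvec h w"
  moreover obtain U where "good U" "h \<in> U"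
    using good_exists[OF h] .
  ultimately show "v = w"
    using tvec_chart_self by metis
qed

text \<open>A chart around \<open>h\<close> itself reads \<open>tvec h v\<close> as
  \<open>v\<close>, so a tangent vector must be \<open>tvec h\<close> of its coordinates there, and
  the transition derivatives fix the rest. Conversely, the transition from the chart at \<gamma>h to
  that at \<delta>h has derivative \<rho>(\<delta>\<gamma>^-1), which takes
  \<open>\<rho> \<gamma> v\<close> to \<open>\<rho> \<delta> v\<close>.\<close>

lemma tangent_space_base:
  assumes h: "h \<in> carrier G"
  shows "tangent_space base (pr h) = range (tvec h)"
proof (intro equalityI subsetI)
  fix \<xi> assume \<xi>: "\<xi> \<in> tangent_space base (pr h)"
  obtain U where U: "good U" "h \<in> U"
    using good_exists[OF h] .
  have Uc: "(pr ` U, coord U) \<in> charts_at base (pr h)"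
    using U baseI by (simp add: charts_at_def)
  have "\<xi> c = tvec h (\<xi> (pr ` U, coord U)) c" for c
  proof (cases "c \<in> charts_at base (pr h)")
    case True
    then obtain V \<gamma> where V: "\<gamma> \<in> \<Gamma>" "good V" "\<gamma> \<otimes> h \<in> V" "c = (pr ` V, coord V)"
      using charts_at_base[OF h] by blast
    have "\<xi> c = frechet_derivative (coord V \<circ> inv_into (pr ` U) (coord U)) (at (coord U (pr h))) (\<xi> (pr ` U, coord U))"
      using \<xi> Uc True unfolding tangent_space_def V(4) by blast
    also have "\<dots> = \<rho> \<gamma> (\<xi> (pr ` U, coord U))"
      using frechet_derivative_eq[OF has_derivative_transition[OF U V(2,1,3)]]
      by (simp only: coord_pr_self[OF U])
    finally show ?thesis
      using V h by (simp add: tvec_chart)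
  next
    case False
    then have "\<xi> c = 0"
      using \<xi> unfolding tangent_space_def by blast
    then show ?thesis
      using False h by (simp add: tvec_outside)
  qed
  then have "\<xi> = tvec h (\<xi> (pr ` U, coord U))"
    by (rule ext)
  then show "\<xi> \<in> range (tvec h)"
    by (rule range_eqI)
next
  fix \<xi> assume "\<xi> \<in> range (tvec h)"
  then obtain v where v: "\<xi> = tvec h v" by auto
  have "\<xi> (W', \<psi>) = frechet_derivative (\<psi> \<circ> inv_into W \<phi>) (at (\<phi> (pr h))) (\<xi> (W, \<phi>))"
    if c: "(W, \<phi>) \<in> charts_at base (pr h)" "(W', \<psi>) \<in> charts_at base (pr h)" for W \<phi> W' \<psi>
  proof -
    obtain U \<gamma> where U: "\<gamma> \<in> \<Gamma>" "good U" "\<gamma> \<otimes> h \<in> U" "W = pr ` U" "\<phi> = coord U"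
      using c(1)[unfolded charts_at_base[OF h] prod.inject] by blast
    obtain V \<delta> where V: "\<delta> \<in> \<Gamma>" "good V" "\<delta> \<otimes> h \<in> V" "W' = pr ` V" "\<psi> = coord V"
      using c(2)[unfolded charts_at_base[OF h] prod.inject] by blast
    have *: "\<delta> \<otimes> inv \<gamma> \<in> \<Gamma>" "(\<delta> \<otimes> inv \<gamma>) \<otimes> (\<gamma> \<otimes> h) = \<delta> \<otimes> h"
      by (rule \<Gamma>_quotient[OF V(1) U(1) h])+
    have "frechet_derivative (\<psi> \<circ> inv_into W \<phi>) (at (\<phi> (pr h))) = \<rho> (\<delta> \<otimes> inv \<gamma>)"
      unfolding U(4,5) V(5) coord_pr[OF U(2) h U(1,3)]
      by (rule frechet_derivative_eq[OF has_derivative_transition]) (use U V * in auto)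
    moreover have "\<xi> (W, \<phi>) = \<rho> \<gamma> v" "\<xi> (W', \<psi>) = \<rho> \<delta> v"
      using U V h by (simp_all add: v tvec_chart)
    ultimately show ?thesis
      using U V by (simp add: \<rho>_mult)
  qed
  then show "\<xi> \<in> tangent_space base (pr h)"
    unfolding tangent_space_def using tvec_outside[OF h] v by blast
qed

section \<open>The tangent torus bundle\<close>

definition \<rho>_blinfun :: "real ^ 'n \<Rightarrow> (real ^ 'n) \<Rightarrow>\<^sub>L (real ^ 'n)" where
  "\<rho>_blinfun x = Blinfun (\<rho> (Dinv x))"

lemma \<rho>_blinfun_apply [simp]: "blinfun_apply (\<rho>_blinfun x) y = \<rho> (Dinv x) y"
  by (simp add: \<rho>_blinfun_def bounded_linear_Blinfun_apply bounded_linear_\<rho>)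

text \<open>The operator is the sum of its columns: \<open>Q j w\<close> is the rank-one operator
  \<open>v \<mapsto> v $ j *\<^sub>R w\<close>, which is linear in \<open>w\<close>, and each column
  \<open>\<rho> (Dinv x) (axis j 1)\<close> is smooth in \<open>x\<close> by
  \<open>\<rho>_eq\<close>. Thus smoothness at each fixed vector gives smoothness in operator
  norm.\<close>

lemma smooth_on_\<rho>_blinfun: "smooth_on UNIV \<rho>_blinfun"
proof -
  define Q where "Q j w = blinfun_scaleR_left w o\<^sub>L Blinfun (\<lambda>v. v $ j)" for j :: 'n and w :: "real ^ 'n"
  have Q_apply: "blinfun_apply (Q j w) v = v $ j *\<^sub>R w" for j w v
    by (simp add: Q_def bounded_linear_Blinfun_apply bounded_linear_vec_nth)
  have Q_linear: "bounded_linear (Q j)" for j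
    unfolding Q_def[abs_def]
    by (rule bounded_linear_compose[OF
          bounded_bilinear.bounded_linear_left[OF bounded_bilinear_blinfun_compose]
          bounded_linear_blinfun_scaleR_left])
  have smooth_\<rho>: "smooth_on UNIV (\<lambda>x. \<rho> (Dinv x) y)" for y
  proof -
    have "smooth_on UNIV (\<lambda>x. (\<lambda>z. D (Dinv (fst z) \<otimes> Dinv (snd z))) (x, y))"
      by (rule smooth_on_compose[OF open_UNIV smooth_on_Pair[OF open_UNIV
              smooth_on_bounded_linear[OF bounded_linear_ident] smooth_on_const] smooth_on_mult]) simp
    from smooth_on_diff[OF open_UNIV this smooth_on_bounded_linear[OF bounded_linear_ident]]
    show ?thesis
      by (simp add: \<rho>_eq)
  qed
  have "smooth_on UNIV (\<lambda>x. \<Sum>j\<in>UNIV. Q j (\<rho> (Dinv x) (axis j 1)))"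
    by (rule smooth_on_sum[OF open_UNIV smooth_on_linear_comp[OF Q_linear open_UNIV smooth_\<rho>]])
  moreover have "(\<Sum>j\<in>UNIV. Q j (\<rho> (Dinv x) (axis j 1))) = \<rho>_blinfun x" for x
  proof (rule blinfun_eqI)
    fix v :: "real ^ 'n"
    have "\<rho> (Dinv x) (\<Sum>j\<in>UNIV. v $ j *\<^sub>R axis j 1) = (\<Sum>j\<in>UNIV. v $ j *\<^sub>R \<rho> (Dinv x) (axis j 1))"
      by (simp add: linear_sum[OF linear_\<rho>] linear_scale[OF linear_\<rho>])
    then show "blinfun_apply (\<Sum>j\<in>UNIV. Q j (\<rho> (Dinv x) (axis j 1))) v = blinfun_apply (\<rho>_blinfun x) v"
      by (simp add: blinfun.sum_left Q_apply basis_expansion[of v, unfolded scalar_mult_eq_scaleR])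
  qed
  ultimately show ?thesis
    by simp
qed

lemma representation_\<rho>: "additive_representation G \<rho>"
  by unfold_locales (simp_all add: linear_add[OF linear_\<rho>] \<rho>_mult)

lemma int_vectors_closed:
  "0 \<in> int_vectors" "x \<in> int_vectors \<Longrightarrow> y \<in> int_vectors \<Longrightarrow> x + y \<in> int_vectors"
  "x \<in> int_vectors \<Longrightarrow> - x \<in> int_vectors"
  by (auto simp: int_vectors_def)

lemma int_vectors_discrete:
  assumes "x \<in> int_vectors" "norm x < 1"
  shows "x = 0"
proof -
  have "x $ i = 0" for i
    using assms component_le_norm_cart[of x i] Ints_nonzero_abs_less1[of "x $ i"]
    by (auto simp: int_vectors_def)
  then show ?thesis
    by (simp add: vec_eq_iff)
qed

lemma int_vectors_eq: "int_vectors = range (\<lambda>z :: 'n \<Rightarrow> int. \<Sum>i\<in>UNIV. of_int (z i) *\<^sub>R axis i (1::real))"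
proof (intro equalityI subsetI)
  fix v :: "real ^ 'n" assume "v \<in> int_vectors"
  then have "\<exists>z. v $ i = of_int z" for i
    by (auto simp: int_vectors_def elim: Ints_cases)
  then obtain z where "\<And>i. v $ i = of_int (z i)"
    by metis
  then have "v = (\<Sum>i\<in>UNIV. of_int (z i) *\<^sub>R axis i 1)"
    by (subst basis_expansion[of v, symmetric]) (simp add: scalar_mult_eq_scaleR)
  then show "v \<in> range (\<lambda>z. \<Sum>i\<in>UNIV. of_int (z i) *\<^sub>R axis i (1::real))"
    by blast
qed (auto simp: int_vectors_def axis_def intro!: Ints_sum Ints_mult)

text \<open>\<open>Lam\<close> collects the integer spans for all representatives of the coset. By
  equivariance of the frame and integrality of \<rho> on \<Gamma>, the span at any representative
  lies in the span at \<open>h\<close>.\<close>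

lemma Lam_base:
  assumes h: "h \<in> carrier G"
  shows "Lam G \<Gamma> D (pr h) = tvec h ` int_vectors"
proof -
  have span: "(\<lambda>c. \<Sum>i\<in>UNIV. of_int (z i) *\<^sub>R
      differential base (\<lambda>x. pr (Dinv x)) (D k) (axis i 1) c) = tvec k (\<Sum>i\<in>UNIV. of_int (z i) *\<^sub>R axis i 1)"
    if "k \<in> carrier G" for k and z :: "'n \<Rightarrow> int"
    unfolding tvec_def[symmetric]
    by (rule ext) (simp add: linear_sum[OF linear_tvec[OF that]] linear_scale[OF linear_tvec[OF that]])
  have "Lam G \<Gamma> D (pr h) = (\<Union>k\<in>{k \<in> carrier G. pr h = pr k}. tvec k ` int_vectors)"
  proof (intro equalityI subsetI)
    fix \<xi> assume "\<xi> \<in> Lam G \<Gamma> D (pr h)"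
    then obtain k and z :: "'n \<Rightarrow> int" where k: "k \<in> carrier G" "pr h = pr k"
      "\<xi> = (\<lambda>c. \<Sum>i\<in>UNIV. of_int (z i) *\<^sub>R differential base (\<lambda>x. pr (Dinv x)) (D k) (axis i 1) c)"
      unfolding Lam_def by blast
    show "\<xi> \<in> (\<Union>k\<in>{k \<in> carrier G. pr h = pr k}. tvec k ` int_vectors)"
      unfolding int_vectors_eq k(3) span[OF k(1)] using k(1,2) by blast
  next
    fix \<xi> assume "\<xi> \<in> (\<Union>k\<in>{k \<in> carrier G. pr h = pr k}. tvec k ` int_vectors)"
    then obtain k and z :: "'n \<Rightarrow> int" where k: "k \<in> carrier G" "pr h = pr k"
      "\<xi> = tvec k (\<Sum>i\<in>UNIV. of_int (z i) *\<^sub>R axis i 1)"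
      unfolding int_vectors_eq by blast
    show "\<xi> \<in> Lam G \<Gamma> D (pr h)"
      unfolding Lam_def k(3) span[OF k(1), symmetric] using k(1,2) by blast
  qed
  also have "\<dots> = tvec h ` int_vectors"
  proof -
    have "tvec k ` int_vectors \<subseteq> tvec h ` int_vectors" if k: "k \<in> carrier G" "pr h = pr k" for k
    proof -
      obtain \<gamma> where \<gamma>: "\<gamma> \<in> \<Gamma>" "h = \<gamma> \<otimes> k"
        using pr_eq_iff[OF k(1) h] k(2) by auto
      have "tvec k v = tvec h (\<rho> \<gamma> v)" for v
        unfolding \<gamma>(2) using tvec_\<Gamma>[OF \<gamma>(1) k(1)] by simp
      then show ?thesis
        using \<rho>_int_vectors[OF \<gamma>(1)] by auto
    qed
    then show ?thesis
      using h by blast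
  qed
  finally show ?thesis .
qed

lemma tangent_bundle_base:
  "tangent_bundle base = (\<lambda>(h, v). (pr h, tvec h v)) ` (carrier G \<times> UNIV)"
proof -
  have "tangent_bundle base = (\<Union>h\<in>carrier G. {pr h} \<times> range (tvec h))"
    unfolding tangent_bundle_def points_base using tangent_space_base by fastforce
  then show ?thesis
    by auto
qed

lemma torus_bundle_tangent:
  "torus_bundle G A D \<Gamma> \<rho> \<rho>_blinfun int_vectors 1 (tangent_atlas base)
    (\<lambda>(h, v). (pr h, tvec h v)) (Xdual_proj G \<Gamma> D)"
proof (intro torus_bundle.intro torus_bundle_axioms.intro integral_affine_quotient_axioms
    representation_\<rho> smooth_on_\<rho>_blinfun \<rho>_blinfun_apply int_vectors_closed \<rho>_int_vectors int_vectors_discrete)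
  fix U assume U: "good U"
  define \<kappa> where "\<kappa> = (\<lambda>(p, \<xi> :: ('g set, real ^ 'n) chart \<Rightarrow> real ^ 'n). (coord U p, \<xi> (pr ` U, coord U)))"
  have "((SIGMA p : pr ` U. tangent_space base p), \<kappa>) \<in> tangent_atlas base"
    unfolding tangent_atlas_def \<kappa>_def using baseI[OF U] by blast
  moreover have "(SIGMA p : pr ` U. tangent_space base p) = (\<lambda>(h, v). (pr h, tvec h v)) ` (U \<times> UNIV)"
    using tangent_space_base good_carrier[OF U] by auto
  moreover have "\<kappa> (pr h, tvec h v) = (D h, v)" if "h \<in> U" for h v
    using coord_pr_self[OF U that] tvec_chart_self[OF U that] by (simp add: \<kappa>_def)
  ultimately show "\<exists>\<kappa>. ((\<lambda>(h, v). (pr h, tvec h v)) ` (U \<times> UNIV), \<kappa>) \<in> tangent_atlas base \<and>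
      (\<forall>h\<in>U. \<forall>v. \<kappa> (case (h, v) of (h, v) \<Rightarrow> (pr h, tvec h v)) = (D h, v))"
    by (intro exI[of _ \<kappa>]) simp
next
  fix W \<kappa> assume "(W, \<kappa>) \<in> tangent_atlas base"
  then have "W \<subseteq> tangent_bundle base"
    unfolding tangent_atlas_def tangent_bundle_def by (auto intro: pointsI)
  then show "W \<subseteq> (\<lambda>(h, v). (pr h, tvec h v)) ` (carrier G \<times> UNIV)"
    by (simp only: tangent_bundle_base)
next
  fix h h' v v' assume h: "h \<in> carrier G" "h' \<in> carrier G"
  show "Xdual_proj G \<Gamma> D (case (h, v) of (h, v) \<Rightarrow> (pr h, tvec h v)) =
      Xdual_proj G \<Gamma> D (case (h', v') of (h, v) \<Rightarrow> (pr h, tvec h v)) \<longleftrightarrow>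
      (\<exists>\<gamma>\<in>\<Gamma>. \<exists>m\<in>int_vectors. h' = \<gamma> \<otimes> h \<and> v' = m + \<rho> \<gamma> v)"
    unfolding Xdual_proj_def prod.case
    by (rule fibre_proj_frame_eq_iff[OF tangent_bundle_base _ inj_tvec tvec_\<Gamma> Lam_base int_vectors_closed h])
      (simp_all add: linear_add[OF linear_tvec])
qed simp_all

section \<open>The cotangent torus bundle\<close>

abbreviation \<rho>d :: "'g \<Rightarrow> ((real ^ 'n) \<Rightarrow>\<^sub>L real) \<Rightarrow> ((real ^ 'n) \<Rightarrow>\<^sub>L real)" where
  "\<rho>d \<equiv> dual_rep_action G D"

lemma \<rho>d_apply [simp]: "g \<in> carrier G \<Longrightarrow> blinfun_apply (\<rho>d g l) v = blinfun_apply l (\<rho> (inv g) v)"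
  by (simp add: dual_rep_action_def bounded_linear_Blinfun_apply bounded_linear_\<rho>)

lemma representation_\<rho>d: "additive_representation G \<rho>d"
  by unfold_locales (auto intro!: blinfun_eqI simp: blinfun.add_left inv_mult_group \<rho>_mult)

text \<open>The dual representation is precomposition with \<rho> of the inverse. Written with
  \<open>prod_left\<close>, it depends linearly on that operator, so its smoothness follows from
  those of the inverse and of \<open>\<rho>_blinfun\<close>.\<close>

definition \<rho>d_blinfun :: "real ^ 'n \<Rightarrow> ((real ^ 'n) \<Rightarrow>\<^sub>L real) \<Rightarrow>\<^sub>L ((real ^ 'n) \<Rightarrow>\<^sub>L real)" where
  "\<rho>d_blinfun x = bounded_bilinear.prod_left (o\<^sub>L) (\<rho>_blinfun (D (inv Dinv x)))"

lemma \<rho>d_blinfun_apply: "blinfun_apply (\<rho>d_blinfun x) l = \<rho>d (Dinv x) l"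
  by (simp add: \<rho>d_blinfun_def bounded_bilinear.prod_left.rep_eq[OF bounded_bilinear_blinfun_compose]
      dual_rep_action_def \<rho>_blinfun_def)

lemma smooth_on_\<rho>d_blinfun: "smooth_on UNIV \<rho>d_blinfun"
  unfolding \<rho>d_blinfun_def[abs_def]
  by (rule smooth_on_linear_comp[OF bounded_bilinear.bounded_linear_prod_left[OF bounded_bilinear_blinfun_compose]
        open_UNIV smooth_on_compose[OF open_UNIV smooth_on_inv smooth_on_\<rho>_blinfun]]) simp

lemma int_covectors_closed:
  "0 \<in> int_covectors" "x \<in> int_covectors \<Longrightarrow> y \<in> int_covectors \<Longrightarrow> x + y \<in> int_covectors"
  "x \<in> int_covectors \<Longrightarrow> - x \<in> int_covectors"
  by (auto simp: int_covectors_def blinfun.add_left blinfun.minus_left)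

lemma axis_int_vector: "axis i 1 \<in> int_vectors"
  by (auto simp: int_vectors_def axis_def)

lemma blinfun_axis_expansion:
  fixes l :: "(real ^ 'n) \<Rightarrow>\<^sub>L real"
  shows "blinfun_apply l v = (\<Sum>i\<in>UNIV. v $ i * blinfun_apply l (axis i 1))"
  using arg_cong[OF basis_expansion[of v, unfolded scalar_mult_eq_scaleR], of "blinfun_apply l"]
  by (simp add: blinfun.sum_right blinfun.scaleR_right)

text \<open>The vectors \<open>axis i 1\<close> have norm 1, so \<open>norm l\<close> bounds the
  values of \<open>l\<close> on them, and integers of absolute value below 1 vanish. The separation
  constant is therefore 1, as for integer vectors.\<close>

lemma int_covectors_discrete:
  fixes l :: "(real ^ 'n) \<Rightarrow>\<^sub>L real"
  assumes "l \<in> int_covectors" "norm l < 1"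
  shows "l = 0"
proof -
  have "blinfun_apply l (axis i 1) = 0" for i
  proof -
    have "norm (blinfun_apply l (axis i 1)) < 1"
      using norm_blinfun[of l "axis i 1"] assms(2) by simp
    moreover have "blinfun_apply l (axis i 1) \<in> \<int>"
      using assms(1) axis_int_vector by (auto simp: int_covectors_def)
    ultimately show ?thesis
      using Ints_nonzero_abs_less1 by auto
  qed
  then have "blinfun_apply l v = 0" for v
    by (subst blinfun_axis_expansion) simp
  then show ?thesis
    by (intro blinfun_eqI) simp
qed

text \<open>The pairing moves \<open>inv \<gamma>\<close> onto the vector argument, and
  \<open>inv \<gamma>\<close> again lies in \<Gamma>.\<close>

lemma \<rho>d_int_covectors:
  assumes "\<gamma> \<in> \<Gamma>" "l \<in> int_covectors"
  shows "\<rho>d \<gamma> l \<in> int_covectors"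
  using assms \<rho>_int_vectors subgroup.m_inv_closed[OF subgroup_\<Gamma>] by (simp add: int_covectors_def)

definition proj :: "'n \<Rightarrow> (real ^ 'n) \<Rightarrow>\<^sub>L real" where
  "proj i = Blinfun (\<lambda>v. v $ i)"

lemma proj_apply [simp]: "blinfun_apply (proj i) v = v $ i"
  by (simp add: proj_def bounded_linear_Blinfun_apply bounded_linear_vec_nth)

lemma int_covectors_eq: "int_covectors = range (\<lambda>z :: 'n \<Rightarrow> int. \<Sum>i\<in>UNIV. of_int (z i) *\<^sub>R proj i)"
proof (intro equalityI subsetI)
  fix l :: "(real ^ 'n) \<Rightarrow>\<^sub>L real" assume "l \<in> int_covectors"
  then have "\<exists>z. blinfun_apply l (axis i 1) = of_int z" for i
    using axis_int_vector[of i] unfolding int_covectors_def by (blast elim: Ints_cases)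
  then obtain z where z: "\<And>i. blinfun_apply l (axis i 1) = of_int (z i)"
    by metis
  have "l = (\<Sum>i\<in>UNIV. of_int (z i) *\<^sub>R proj i)"
  proof (rule blinfun_eqI)
    show "blinfun_apply l v = blinfun_apply (\<Sum>i\<in>UNIV. of_int (z i) *\<^sub>R proj i) v" for v
      by (subst blinfun_axis_expansion) (simp add: z blinfun.sum_left blinfun.scaleR_left mult.commute)
  qed
  then show "l \<in> range (\<lambda>z. \<Sum>i\<in>UNIV. of_int (z i) *\<^sub>R proj i)"
    by blast
qed (auto simp: int_covectors_def int_vectors_def blinfun.sum_left blinfun.scaleR_left intro!: Ints_sum Ints_mult)

text \<open>The frame dual to \<open>tvec\<close>: \<open>l\<close> is applied to the coordinates of
  \<xi> in the frame at \<open>h\<close>. The value 0 elsewhere follows the convention of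
  \<open>cotangent_space\<close>.\<close>

definition covec :: "'g \<Rightarrow> ((real ^ 'n) \<Rightarrow>\<^sub>L real) \<Rightarrow> (('g set, real ^ 'n) chart \<Rightarrow> real ^ 'n) \<Rightarrow> real" where
  "covec h l \<xi> = (if \<xi> \<in> tangent_space base (pr h) then blinfun_apply l (inv_into UNIV (tvec h) \<xi>) else 0)"

lemma covec_tvec [simp]: "h \<in> carrier G \<Longrightarrow> covec h l (tvec h v) = blinfun_apply l v"
  by (simp add: covec_def tangent_space_base inj_tvec)

lemma covec_outside: "\<xi> \<notin> tangent_space base (pr h) \<Longrightarrow> covec h l \<xi> = 0"
  by (simp add: covec_def)

lemma covec_eqI:
  assumes "h \<in> carrier G" "\<And>\<xi>. \<xi> \<notin> tangent_space base (pr h) \<Longrightarrow> \<omega> \<xi> = 0"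
    and "\<And>v. \<omega> (tvec h v) = blinfun_apply l v"
  shows "\<omega> = covec h l"
proof
  fix \<xi>
  show "\<omega> \<xi> = covec h l \<xi>"
  proof (cases "\<xi> \<in> tangent_space base (pr h)")
    case True
    then obtain v where "\<xi> = tvec h v"
      using tangent_space_base[OF assms(1)] by auto
    then show ?thesis
      using assms by simp
  qed (simp add: assms covec_outside)
qed

lemma linear_covec: "linear (\<lambda>l. covec h l \<xi>)"
  by (rule linearI) (simp_all add: covec_def blinfun.add_left blinfun.scaleR_left)

lemma inj_covec:
  assumes "h \<in> carrier G"
  shows "inj (covec h)"
proof (rule injI)
  fix l m assume "covec h l = covec h m"
  then have "blinfun_apply l v = blinfun_apply m v" for v
    using covec_tvec[OF assms] by metis
  then show "l = m"
    by (rule blinfun_eqI)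
qed

text \<open>Both sides are tested on \<open>tvec h v\<close>, rewritten as
  \<open>tvec (\<gamma> \<otimes> h) (\<rho> \<gamma> v)\<close>; the inverse inside
  \<open>\<rho>d \<gamma>\<close> cancels \<open>\<rho> \<gamma>\<close>.\<close>

lemma covec_\<Gamma>:
  assumes "\<gamma> \<in> \<Gamma>" "h \<in> carrier G"
  shows "covec (\<gamma> \<otimes> h) (\<rho>d \<gamma> l) = covec h l"
proof (rule covec_eqI[OF assms(2)])
  fix v
  have "covec (\<gamma> \<otimes> h) (\<rho>d \<gamma> l) (tvec (\<gamma> \<otimes> h) (\<rho> \<gamma> v)) = blinfun_apply l v"
    using assms by (simp del: covec_tvec add: covec_tvec[of "\<gamma> \<otimes> h"])
  then show "covec (\<gamma> \<otimes> h) (\<rho>d \<gamma> l) (tvec h v) = blinfun_apply l v"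
    using assms by (simp only: tvec_\<Gamma>)
qed (use assms in \<open>simp add: covec_outside\<close>)

lemma tvec_add: "h \<in> carrier G \<Longrightarrow> (\<lambda>c. tvec h v c + tvec h w c) = tvec h (v + w)"
  by (rule ext) (simp add: linear_add[OF linear_tvec])

lemma tvec_scaleR: "h \<in> carrier G \<Longrightarrow> (\<lambda>c. a *\<^sub>R tvec h v c) = tvec h (a *\<^sub>R v)"
  by (rule ext) (simp add: linear_scale[OF linear_tvec])

text \<open>Pulled back along \<open>tvec h\<close>, a covector is a linear functional on a
  finite-dimensional space, hence bounded, and so has the form required by
  \<open>covec\<close>.\<close>

lemma cotangent_space_base:
  assumes h: "h \<in> carrier G"
  shows "cotangent_space base (pr h) = range (covec h)"
proof (intro equalityI subsetI)
  fix \<omega> assume \<omega>: "\<omega> \<in> cotangent_space base (pr h)"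
  have T: "tvec h v \<in> tangent_space base (pr h)" for v
    using tangent_space_base[OF h] by blast
  have "\<omega> (tvec h (v + w)) = \<omega> (tvec h v) + \<omega> (tvec h w)" for v w
    using \<omega> T unfolding cotangent_space_def tvec_add[OF h, symmetric] by blast
  moreover have "\<omega> (tvec h (a *\<^sub>R v)) = a *\<^sub>R \<omega> (tvec h v)" for a v
    using \<omega> T unfolding cotangent_space_def tvec_scaleR[OF h, symmetric] real_scaleR_def by blast
  ultimately have "linear (\<lambda>v. \<omega> (tvec h v))"
    by (rule linearI)
  then have "bounded_linear (\<lambda>v. \<omega> (tvec h v))"
    by (simp add: linear_conv_bounded_linear)
  then have "\<omega> = covec h (Blinfun (\<lambda>v. \<omega> (tvec h v)))"
    using \<omega> unfolding cotangent_space_def by (intro covec_eqI[OF h]) (auto simp: bounded_linear_Blinfun_apply)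
  then show "\<omega> \<in> range (covec h)"
    by (rule range_eqI)
next
  fix \<omega> assume "\<omega> \<in> range (covec h)"
  then obtain l where "\<omega> = covec h l" by auto
  then show "\<omega> \<in> cotangent_space base (pr h)"
    unfolding cotangent_space_def using h
    by (auto simp: covec_outside tangent_space_base tvec_add tvec_scaleR blinfun.add_right blinfun.scaleR_right)
qed

text \<open>The chart picked by \<open>SOME\<close> is unknown, but it selects some representative
  \<gamma>k. The vector has coordinates \<open>\<rho> \<gamma> v\<close> there, and the transition
  back to \<open>U\<close> has derivative \<open>\<rho> (inv \<gamma>)\<close>, so the choice
  cancels.\<close>

lemma function_differential_coord:
  assumes U: "good U" "k \<in> U"
  shows "function_differential base (\<lambda>b. coord U b $ i) (pr k) = covec k (proj i)"
proof (rule covec_eqI)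
  show k: "k \<in> carrier G"
    using good_carrier[OF U] .
  show "function_differential base (\<lambda>b. coord U b $ i) (pr k) \<xi> = 0" if "\<xi> \<notin> tangent_space base (pr k)" for \<xi>
    using that by (simp add: function_differential_def)
  fix v
  have "(pr ` U, coord U) \<in> charts_at base (pr k)"
    using U baseI by (simp add: charts_at_def)
  then have "(SOME c. c \<in> charts_at base (pr k)) \<in> charts_at base (pr k)"
    by (rule someI)
  then obtain V \<gamma> where V: "\<gamma> \<in> \<Gamma>" "good V" "\<gamma> \<otimes> k \<in> V"
      "(SOME c. c \<in> charts_at base (pr k)) = (pr ` V, coord V)"
    using charts_at_base[OF k] by blast
  have "((coord U \<circ> inv_into (pr ` V) (coord V)) has_derivative \<rho> (inv \<gamma>)) (at (D (\<gamma> \<otimes> k)))"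
    by (rule has_derivative_transition[OF V(2,3) U(1)])
      (use V U k subgroup.m_inv_closed[OF subgroup_\<Gamma>] in \<open>auto simp: m_assoc[symmetric]\<close>)
  from bounded_linear.has_derivative[OF bounded_linear_vec_nth this]
  have "frechet_derivative ((\<lambda>b. coord U b $ i) \<circ> inv_into (pr ` V) (coord V)) (at (D (\<gamma> \<otimes> k))) = (\<lambda>v. \<rho> (inv \<gamma>) v $ i)"
    unfolding o_def by (rule frechet_derivative_eq)
  moreover have "coord V (pr k) = D (\<gamma> \<otimes> k)"
    by (rule coord_pr[OF V(2) k V(1,3)])
  moreover have "tvec k v (pr ` V, coord V) = \<rho> \<gamma> v"
    by (rule tvec_chart[OF V(2) k V(1,3)])
  moreover have "tvec k v \<in> tangent_space base (pr k)"
    using tangent_space_base[OF k] by blast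
  ultimately show "function_differential base (\<lambda>b. coord U b $ i) (pr k) (tvec k v) = blinfun_apply (proj i) v"
    unfolding function_differential_def V(4) using V(1) by simp
qed

text \<open>A chart at the coset may select another representative \<gamma>h and then yields
  covectors in the frame at \<gamma>h. Returning to the frame at \<open>h\<close> applies
  \<open>\<rho>d (inv \<gamma>)\<close>, which preserves integer covectors.\<close>

lemma Lam_dual_base:
  assumes h: "h \<in> carrier G"
  shows "Lam_dual G \<Gamma> D (pr h) = covec h ` int_covectors"
proof -
  have span: "(\<lambda>\<xi>. \<Sum>i\<in>UNIV. of_int (z i) * function_differential base (\<lambda>b. coord U b $ i) (pr k) \<xi>)
      = covec k (\<Sum>i\<in>UNIV. of_int (z i) *\<^sub>R proj i)"
    if "good U" "k \<in> U" for U k and z :: "'n \<Rightarrow> int"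
    unfolding function_differential_coord[OF that]
    by (rule ext) (simp add: linear_sum[OF linear_covec] linear_scale[OF linear_covec])
  show ?thesis
  proof (intro equalityI subsetI)
    fix \<omega> assume "\<omega> \<in> Lam_dual G \<Gamma> D (pr h)"
    then obtain W r and z :: "'n \<Rightarrow> int" where "(W, r) \<in> charts_at base (pr h)"
      and \<omega>: "\<omega> = (\<lambda>\<xi>. \<Sum>i\<in>UNIV. of_int (z i) * function_differential base (\<lambda>b. r b $ i) (pr h) \<xi>)"
      unfolding Lam_dual_def by blast
    then obtain U \<gamma> where U: "\<gamma> \<in> \<Gamma>" "good U" "\<gamma> \<otimes> h \<in> U" "r = coord U"
      unfolding charts_at_base[OF h] prod.inject by blast
    define l where "l = (\<Sum>i\<in>UNIV. of_int (z i) *\<^sub>R proj i)"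
    have "\<omega> = covec (\<gamma> \<otimes> h) l"
      using span[OF U(2,3), of z] h U(1) by (simp add: \<omega> U(4) l_def)
    also have "\<dots> = covec (\<gamma> \<otimes> h) (\<rho>d \<gamma> (\<rho>d (inv \<gamma>) l))"
      using U(1) additive_representation.rep_mult[OF representation_\<rho>d, of \<gamma> "inv \<gamma>" l]
        additive_representation.rep_one[OF representation_\<rho>d, of l] by simp
    also have "\<dots> = covec h (\<rho>d (inv \<gamma>) l)"
      by (rule covec_\<Gamma>[OF U(1) h])
    finally have "\<omega> = covec h (\<rho>d (inv \<gamma>) l)" .
    moreover have "\<rho>d (inv \<gamma>) l \<in> int_covectors"
      using \<rho>d_int_covectors subgroup.m_inv_closed[OF subgroup_\<Gamma> U(1)] int_covectors_eq l_def by blast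
    ultimately show "\<omega> \<in> covec h ` int_covectors"
      by blast
  next
    fix \<omega> assume "\<omega> \<in> covec h ` int_covectors"
    then obtain z :: "'n \<Rightarrow> int" where z: "\<omega> = covec h (\<Sum>i\<in>UNIV. of_int (z i) *\<^sub>R proj i)"
      unfolding int_covectors_eq by blast
    obtain U where U: "good U" "h \<in> U"
      using good_exists[OF h] .
    then have "(pr ` U, coord U) \<in> charts_at base (pr h)"
      using baseI by (simp add: charts_at_def)
    then show "\<omega> \<in> Lam_dual G \<Gamma> D (pr h)"
      unfolding Lam_dual_def z span[OF U, symmetric] by blast
  qed
qed

lemma cotangent_bundle_base:
  "cotangent_bundle base = (\<lambda>(h, l). (pr h, covec h l)) ` (carrier G \<times> UNIV)"
proof -
  have "cotangent_bundle base = (\<Union>h\<in>carrier G. {pr h} \<times> range (covec h))"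
    unfolding cotangent_bundle_def points_base using cotangent_space_base by fastforce
  then show ?thesis
    by auto
qed

text \<open>The charts of \<open>cotangent_atlas\<close> evaluate covectors on these vectors;
  identifying them with the frame lets such a chart read \<open>covec h l\<close> as
  \<open>l\<close>.\<close>

lemma differential_inv_coord:
  assumes U: "good U" "h \<in> U"
  shows "differential base (inv_into (pr ` U) (coord U)) (D h) v = tvec h v"
proof
  fix c
  have h: "h \<in> carrier G"
    using good_carrier[OF U] .
  show "differential base (inv_into (pr ` U) (coord U)) (D h) v c = tvec h v c"
  proof (cases "c \<in> charts_at base (pr h)")
    case True
    then obtain V \<gamma> where V: "\<gamma> \<in> \<Gamma>" "good V" "\<gamma> \<otimes> h \<in> V" "c = (pr ` V, coord V)"
      using charts_at_base[OF h] by blast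
    have "differential base (inv_into (pr ` U) (coord U)) (D h) v c = \<rho> \<gamma> v"
      using True frechet_derivative_eq[OF has_derivative_transition[OF U V(2,1,3)]]
      by (simp only: differential_def inv_into_coord[OF U] if_True V(4) snd_conv)
    then show ?thesis
      unfolding V(4) using tvec_chart[OF V(2) h V(1,3)] by simp
  next
    case False
    then have "differential base (inv_into (pr ` U) (coord U)) (D h) v c = 0"
      by (simp only: differential_def inv_into_coord[OF U] if_False)
    then show ?thesis
      using False h by (simp add: tvec_outside)
  qed
qed

lemma torus_bundle_cotangent:
  "torus_bundle G A D \<Gamma> \<rho>d \<rho>d_blinfun int_covectors 1 (cotangent_atlas base)
    (\<lambda>(h, l). (pr h, covec h l)) (X_proj G \<Gamma> D)"
proof (intro torus_bundle.intro torus_bundle_axioms.intro integral_affine_quotient_axioms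
    representation_\<rho>d smooth_on_\<rho>d_blinfun \<rho>d_blinfun_apply int_covectors_closed
    \<rho>d_int_covectors int_covectors_discrete)
  fix U assume U: "good U"
  define \<kappa> where "\<kappa> = (\<lambda>(p, \<omega>). (coord U p,
    Blinfun (\<lambda>v. \<omega> (differential base (inv_into (pr ` U) (coord U)) (coord U p) v) :: real)))"
  have "((SIGMA p : pr ` U. cotangent_space base p), \<kappa>) \<in> cotangent_atlas base"
    unfolding cotangent_atlas_def \<kappa>_def using baseI[OF U] by blast
  moreover have "(SIGMA p : pr ` U. cotangent_space base p) = (\<lambda>(h, l). (pr h, covec h l)) ` (U \<times> UNIV)"
    using cotangent_space_base good_carrier[OF U] by auto
  moreover have "\<kappa> (pr h, covec h l) = (D h, l)" if h: "h \<in> U" for h l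
    using good_carrier[OF U h]
    by (simp only: \<kappa>_def prod.case coord_pr_self[OF U h] differential_inv_coord[OF U h] covec_tvec
        blinfun_apply_inverse)
  ultimately show "\<exists>\<kappa>. ((\<lambda>(h, l). (pr h, covec h l)) ` (U \<times> UNIV), \<kappa>) \<in> cotangent_atlas base \<and>
      (\<forall>h\<in>U. \<forall>l. \<kappa> (case (h, l) of (h, l) \<Rightarrow> (pr h, covec h l)) = (D h, l))"
    by (intro exI[of _ \<kappa>]) simp
next
  fix W \<kappa> assume "(W, \<kappa>) \<in> cotangent_atlas base"
  then have "W \<subseteq> cotangent_bundle base"
    unfolding cotangent_atlas_def cotangent_bundle_def by (auto intro: pointsI)
  then show "W \<subseteq> (\<lambda>(h, l). (pr h, covec h l)) ` (carrier G \<times> UNIV)"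
    by (simp only: cotangent_bundle_base)
next
  fix h h' v v' assume h: "h \<in> carrier G" "h' \<in> carrier G"
  show "X_proj G \<Gamma> D (case (h, v) of (h, l) \<Rightarrow> (pr h, covec h l)) =
      X_proj G \<Gamma> D (case (h', v') of (h, l) \<Rightarrow> (pr h, covec h l)) \<longleftrightarrow>
      (\<exists>\<gamma>\<in>\<Gamma>. \<exists>m\<in>int_covectors. h' = \<gamma> \<otimes> h \<and> v' = m + \<rho>d \<gamma> v)"
    unfolding X_proj_def prod.case
    by (rule fibre_proj_frame_eq_iff[OF cotangent_bundle_base _ inj_covec covec_\<Gamma> Lam_dual_base
          int_covectors_closed h])
      (simp_all add: linear_add[OF linear_covec])
qed simp_all

section \<open>Total spaces and origins in terms of the frames\<close>

lemma pr_one: "pr \<one> = \<Gamma>"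
  by (rule coset_mult_one[OF \<Gamma>_subset])

lemma X_total_eq: "(\<lambda>z. X_proj G \<Gamma> D ((\<lambda>(h, l). (pr h, covec h l)) z)) ` (carrier G \<times> UNIV) = X_total G \<Gamma> D"
  unfolding X_total_def quotient_def image_image[symmetric] cotangent_bundle_base[symmetric]
  by (auto simp: X_proj_def fibre_proj_def)

lemma Xdual_total_eq:
  "(\<lambda>z. Xdual_proj G \<Gamma> D ((\<lambda>(h, v). (pr h, tvec h v)) z)) ` (carrier G \<times> UNIV) = Xdual_total G \<Gamma> D"
  unfolding Xdual_total_def quotient_def image_image[symmetric] tangent_bundle_base[symmetric]
  by (auto simp: Xdual_proj_def fibre_proj_def)

lemma X_origin_eq: "X_proj G \<Gamma> D (pr \<one>, covec \<one> 0) = X_origin G \<Gamma> D"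
proof -
  have "covec \<one> 0 = (\<lambda>_. 0)"
    by (rule ext) (simp add: linear_0[OF linear_covec])
  then show ?thesis
    unfolding X_origin_def pr_one by simp
qed

lemma Xdual_origin_eq: "Xdual_proj G \<Gamma> D (pr \<one>, tvec \<one> 0) = Xdual_origin G \<Gamma> D"
proof -
  have "tvec \<one> 0 = (\<lambda>_. 0)"
    by (rule ext) (simp add: linear_0[OF linear_tvec])
  then show ?thesis
    unfolding Xdual_origin_def pr_one by simp
qed

end

theorem theorem8:
  fixes G :: "('g, 'm) monoid_scheme"
    and A :: "('g, real ^ 'n) atlas"
    and D :: "'g \<Rightarrow> real ^ 'n"
    and \<Gamma> :: "'g set"
  assumes "lie_group G A"
    and "simply_connected_space (manifold_topology A)"
    and "complete_left_invariant_affine_structure G A D"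
    and "D \<one>\<^bsub>G\<^esub> = 0"
    and "lattice_in \<Gamma> G A"
    and "\<forall>\<gamma>\<in>\<Gamma>. linear_rep G D \<gamma> \<in> GL_int"
  shows
    "(\<exists>\<Phi>. smooth_transitive_action
          (semidirect G (dual_rep_action G D) UNIV) (product_atlas A vector_space_atlas)
          (X_total G \<Gamma> D) (X_atlas G \<Gamma> D) \<Phi> \<and>
        stabilizer (semidirect G (dual_rep_action G D) UNIV) \<Phi> (X_origin G \<Gamma> D)
          = carrier (semidirect (G\<lparr>carrier := \<Gamma>\<rparr>) (dual_rep_action G D) int_covectors)) \<and>
     (\<exists>\<Phi>. smooth_transitive_action
          (semidirect G (rep_action G D) UNIV) (product_atlas A vector_space_atlas)
          (Xdual_total G \<Gamma> D) (Xdual_atlas G \<Gamma> D) \<Phi> \<and>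
        stabilizer (semidirect G (rep_action G D) UNIV) \<Phi> (Xdual_origin G \<Gamma> D)
          = carrier (semidirect (G\<lparr>carrier := \<Gamma>\<rparr>) (rep_action G D) int_vectors))"
proof -
  interpret integral_affine_quotient G A D \<Gamma>
    using assms by unfold_locales
  show ?thesis
    using torus_bundle.smooth_transitive_action_torus[OF torus_bundle_cotangent]
      torus_bundle.smooth_transitive_action_torus[OF torus_bundle_tangent]
    unfolding X_total_eq Xdual_total_eq prod.case X_origin_eq Xdual_origin_eq
      X_atlas_def[symmetric] Xdual_atlas_def[symmetric]
    by (rule conjI)
qed

end
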